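(* Let $k\ge1$, $\tau\in(0,1/2]$, and let $\{\mathbf p_z\}_{z\in\{-1,1\}^k}$ be distributions on $\mathcal X$ satisfying: (A1) for every $z$ and $i\in[k]$, $\mathbf p_{z^{\oplus i}}\ll\mathbf p_z$ and there are reals $\alpha_{z,i}$ with $|\alpha_{z,i}|\le\alpha$ ($\alpha$ independent of $z,i$) and measurable $\phi_{z,i}\colon\mathcal X\to\mathbb R$ with $\frac{d\mathbf p_{z^{\oplus i}}}{d\mathbf p_z}=1+\alpha_{z,i}\phi_{z,i}$; and (A2) for all $z$ and $i,j\in[k]$, $\mathbb E_{\mathbf p_z}[\phi_{z,i}\phi_{z,j}]=\mathbf 1\{i=j\}$. Let $\Pi$ be a sequentially interactive protocol using $(\mathcal W_1,\dots,\mathcal W_n)$, let $Z\sim\mathrm{Rad}(\tau)^{\otimes k}$, and let $(Y^n,U)$ be the transcript of $\Pi$ when $X_1,\dots,X_n$ are i.i.d. with distribution $\mathbf p_Z$. Then $$\Big(\frac1k\sum_{i=1}^k d_{\mathrm{TV}}(\mathbf p^{Y^n}_{+i},\mathbf p^{Y^n}_{-i})\Big)^2\le\frac7k\alpha^2\sum_{t=1}^n\max_{z}\max_{W\in\mathcal W_t}\int_{\mathcal Y}\frac{\mathrm{Var}_{\mathbf p_z}[W(y\mid X)]}{\mathbb E_{\mathbf p_z}[W(y\mid X)]}\,d\mu(y).$$ Moreover, if in addition (A3) there is $\sigma\ge0$ such that for all $z$ the random vector $(\phi_{z,i}(X))_{i\in[k]}$, $X\sim\mathbf p_z$, is $\sigma^2$-subgaussian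 with independent coordinates, then $$\Big(\frac1k\sum_{i=1}^k d_{\mathrm{TV}}(\mathbf p^{Y^n}_{+i},\mathbf p^{Y^n}_{-i})\Big)^2\le\frac{14\ln 2}{k}\alpha^2\sigma^2\sum_{t=1}^n\max_{z}\max_{W\in\mathcal W_t}I(\mathbf p_z;W),$$ where $I(\mathbf p_z;W)$ is the mutual information between the input $X\sim\mathbf p_z$ and the output of channel $W$ on input $X$.
   Context: A channel from $\mathcal X$ to a measure space $(\mathcal Y,\mu)$ is a Markov kernel with density $W(y\mid x)$ w.r.t. $\mu$. A sequentially interactive protocol using sets of channels $(\mathcal W_1,\dots,\mathcal W_n)$: mutually independent random variables $U,U_1,\dots,U_n$ independent of the inputs; in round $t$ player $t$, holding $X_t$, sends $Y_t\sim W_t(\cdot\mid X_t,Y_1,\dots,Y_{t-1})$, where the channel is selected as a function of $(U,U_t)$ and, for every fixed past $y^{t-1}$, $x\mapsto W_t(\cdot\mid x,y^{t-1})$ belongs to $\mathcal W_t$; transcript $(Y^n,U)$. $\mathbf p^{Y^n}_z$ is the law of $Y^n$ when inputs are i.i.d. $\mathbf p_z$; $\mathbf p^{Y^n}_{\pm i}=\mathbb E[\mathbf p^{Y^n}_Z\mid Z_i=\pm1]$. $z^{\oplus i}$ flips the $i$th coordinate of $z$. $\mathrm{Rad}(\tau)^{\otimes k}$: independent coordinates, each $=1$ with probability $\tau$, else $-1$. A random vector $V$ is $\sigma^2$-subgaussian if for every unit vector $v$, $\langle V,v\rangle$ has mean zero and $\mathbb E[e^{\lambda\langle V,v\rangle}]\le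 e^{\sigma^2\lambda^2/2}$ for all $\lambda\in\mathbb R$. Mutual information is measured in bits (binary logarithm).
   Formalization: The reference measure μ on the output space is assumed σ-finite; otherwise the claim fails, e.g. for counting measure on [0,1], W(y|x)=1{x=y} and inputs without atoms, where every E[W(y|X)] is 0. *)

theory Defs
  imports "HOL-Probability.Probability"
begin

section \<open>Signs and biased Rademacher vectors\<close>

definition sign_cube :: "nat \<Rightarrow> (nat \<Rightarrow> int) set" where
  "sign_cube k = {..<k} \<rightarrow>\<^sub>E {-1, 1}"

definition flip :: "(nat \<Rightarrow> int) \<Rightarrow> nat \<Rightarrow> nat \<Rightarrow> int" where
  "flip z i = z(i := - z i)"

definition rad_pmf :: "real \<Rightarrow> int pmf" where
  "rad_pmf \<tau> = map_pmf (\<lambda>b. if b then 1 else -1) (bernoulli_pmf \<tau>)"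

text \<open>The default value \<^term>\<open>undefined\<close> makes the support a subset of \<^term>\<open>sign_cube k\<close>.\<close>

definition rad_cube :: "real \<Rightarrow> nat \<Rightarrow> (nat \<Rightarrow> int) pmf" where
  "rad_cube \<tau> k = Pi_pmf {..<k} undefined (\<lambda>_. rad_pmf \<tau>)"

section \<open>Total variation, variance, subgaussian vectors\<close>

definition tv_distance :: "'a measure \<Rightarrow> 'a measure \<Rightarrow> real" where
  "tv_distance P Q = (SUP A\<in>sets P. \<bar>measure P A - measure Q A\<bar>)"

text \<open>The variance is taken in \<open>[0, \<infinity>]\<close>, because the Bochner integral would silently turn
  an infinite variance into \<open>0\<close>.\<close>

definition ext_variance :: "'a measure \<Rightarrow> ('a \<Rightarrow> real) \<Rightarrow> ennreal" where
  "ext_variance P f = (\<integral>\<^sup>+x. ennreal ((f x - (\<integral>x'. f x' \<partial>P))\<^sup>2) \<partial>P)"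

definition subgaussian_vector :: "real \<Rightarrow> nat \<Rightarrow> 'a measure \<Rightarrow> (nat \<Rightarrow> 'a \<Rightarrow> real) \<Rightarrow> bool" where
  "subgaussian_vector s2 k P V \<longleftrightarrow>
     (\<forall>v. (\<Sum>i<k. (v i)\<^sup>2) = 1 \<longrightarrow>
        integrable P (\<lambda>x. \<Sum>i<k. V i x * v i) \<and>
        (\<integral>x. (\<Sum>i<k. V i x * v i) \<partial>P) = 0 \<and>
        (\<forall>l. integrable P (\<lambda>x. exp (l * (\<Sum>i<k. V i x * v i))) \<and>
             (\<integral>x. exp (l * (\<Sum>i<k. V i x * v i)) \<partial>P) \<le> exp (s2 * l\<^sup>2 / 2)))"

section \<open>Channels and their mutual information\<close>

text \<open>A channel is given by its density \<open>W x y = W(y | x)\<close> with respect to \<open>\<mu>\<close>. The measure \<open>X\<close>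
  serves only to supply the measurable space of inputs.\<close>

definition channel :: "'x measure \<Rightarrow> 'y measure \<Rightarrow> ('x \<Rightarrow> 'y \<Rightarrow> real) \<Rightarrow> bool" where
  "channel X \<mu> W \<longleftrightarrow>
     (\<lambda>(x, y). W x y) \<in> borel_measurable (X \<Otimes>\<^sub>M \<mu>) \<and>
     (\<forall>x\<in>space X. (\<forall>y\<in>space \<mu>. 0 \<le> W x y) \<and> (\<integral>\<^sup>+y. ennreal (W x y) \<partial>\<mu>) = 1)"

definition channel_kernel :: "'y measure \<Rightarrow> ('x \<Rightarrow> 'y \<Rightarrow> real) \<Rightarrow> 'x \<Rightarrow> 'y measure" where
  "channel_kernel \<mu> W x = density \<mu> (\<lambda>y. ennreal (W x y))"

definition input_output_law ::
    "'x measure \<Rightarrow> 'y measure \<Rightarrow> ('x \<Rightarrow> 'y \<Rightarrow> real) \<Rightarrow> ('x \<times> 'y) measure" where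
  "input_output_law P \<mu> W =
     P \<bind> (\<lambda>x. channel_kernel \<mu> W x \<bind> (\<lambda>y. return (P \<Otimes>\<^sub>M \<mu>) (x, y)))"

text \<open>The library's \<^const>\<open>KL_divergence\<close> is real-valued and is \<open>0\<close> where the divergence is infinite.
  For probability measures with \<open>N\<close> absolutely continuous with respect to \<open>M\<close>, the negative part of
  \<^term>\<open>entropy_density b M N\<close> is always \<open>N\<close>-integrable, so a failure of integrability means that
  the divergence is \<open>\<infinity>\<close>. As in the library, the reference measure \<open>M\<close> comes first.\<close>

definition ext_KL_divergence :: "real \<Rightarrow> 'a measure \<Rightarrow> 'a measure \<Rightarrow> ennreal" where
  "ext_KL_divergence b M N =
     (if absolutely_continuous M N \<and> integrable N (entropy_density b M N)
      then ennreal (KL_divergence b M N) else \<infinity>)"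

text \<open>Mutual information in bits; compare \<^const>\<open>prob_space.mutual_information\<close>.\<close>

definition channel_information :: "'x measure \<Rightarrow> 'y measure \<Rightarrow> ('x \<Rightarrow> 'y \<Rightarrow> real) \<Rightarrow> ennreal" where
  "channel_information P \<mu> W =
     (let J = input_output_law P \<mu> W
      in ext_KL_divergence 2 (distr J P fst \<Otimes>\<^sub>M distr J \<mu> snd) J)"

section \<open>Sequentially interactive protocols\<close>

text \<open>Rounds are numbered \<open>0, \<dots>, n - 1\<close>. \<open>PU\<close> is the law of the public randomness \<open>U\<close>, \<open>PV t\<close> that of
  the private randomness \<open>U\<^sub>t\<close>, and \<open>G t u v ys x y\<close> is the density at \<open>y\<close> of the message in round \<open>t\<close>
  given \<open>U = u\<close>, \<open>U\<^sub>t = v\<close>, the past messages \<open>ys\<close> and the input \<open>x\<close>; so \<open>G t u v\<close> is the channel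
  selected by player \<open>t\<close>.\<close>

definition interactive_protocol ::
    "'x measure \<Rightarrow> 'y measure \<Rightarrow> nat \<Rightarrow> (nat \<Rightarrow> ('x \<Rightarrow> 'y \<Rightarrow> real) set) \<Rightarrow>
     'u measure \<Rightarrow> (nat \<Rightarrow> 'v measure) \<Rightarrow>
     (nat \<Rightarrow> 'u \<Rightarrow> 'v \<Rightarrow> (nat \<Rightarrow> 'y) \<Rightarrow> 'x \<Rightarrow> 'y \<Rightarrow> real) \<Rightarrow> bool" where
  "interactive_protocol X \<mu> n \<W> PU PV G \<longleftrightarrow>
     prob_space PU \<and> (\<forall>t<n. prob_space (PV t)) \<and>
     (\<forall>t<n. (\<lambda>(u, v, ys, x, y). G t u v ys x y)
        \<in> borel_measurable (PU \<Otimes>\<^sub>M PV t \<Otimes>\<^sub>M PiM {..<t} (\<lambda>_. \<mu>) \<Otimes>\<^sub>M X \<Otimes>\<^sub>M \<mu>)) \<and>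
     (\<forall>t<n. \<forall>u\<in>space PU. \<forall>v\<in>space (PV t). \<forall>ys\<in>space (PiM {..<t} (\<lambda>_. \<mu>)).
        G t u v ys \<in> \<W> t)"

primrec messages_law ::
    "'y measure \<Rightarrow> (nat \<Rightarrow> 'u \<Rightarrow> 'v \<Rightarrow> (nat \<Rightarrow> 'y) \<Rightarrow> 'x \<Rightarrow> 'y \<Rightarrow> real) \<Rightarrow>
     nat \<Rightarrow> 'u \<Rightarrow> (nat \<Rightarrow> 'v) \<Rightarrow> (nat \<Rightarrow> 'x) \<Rightarrow> (nat \<Rightarrow> 'y) measure" where
  "messages_law \<mu> G 0 u vs xs = return (PiM {..<0} (\<lambda>_. \<mu>)) (\<lambda>_. undefined)"
| "messages_law \<mu> G (Suc t) u vs xs =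
     messages_law \<mu> G t u vs xs \<bind> (\<lambda>ys.
       channel_kernel \<mu> (G t u (vs t) ys) (xs t) \<bind> (\<lambda>y.
         return (PiM {..<Suc t} (\<lambda>_. \<mu>)) (ys(t := y))))"

text \<open>Law of the transcript \<open>(Y\<^sup>n, U)\<close> for i.i.d. inputs with law \<open>P\<close>, and its first marginal.\<close>

definition transcript_law ::
    "'y measure \<Rightarrow> nat \<Rightarrow> 'u measure \<Rightarrow> (nat \<Rightarrow> 'v measure) \<Rightarrow>
     (nat \<Rightarrow> 'u \<Rightarrow> 'v \<Rightarrow> (nat \<Rightarrow> 'y) \<Rightarrow> 'x \<Rightarrow> 'y \<Rightarrow> real) \<Rightarrow> 'x measure \<Rightarrow>
     ((nat \<Rightarrow> 'y) \<times> 'u) measure" where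
  "transcript_law \<mu> n PU PV G P =
     PU \<bind> (\<lambda>u. PiM {..<n} PV \<bind> (\<lambda>vs. PiM {..<n} (\<lambda>_. P) \<bind> (\<lambda>xs.
       messages_law \<mu> G n u vs xs \<bind> (\<lambda>ys.
         return (PiM {..<n} (\<lambda>_. \<mu>) \<Otimes>\<^sub>M PU) (ys, u)))))"

definition output_law ::
    "'y measure \<Rightarrow> nat \<Rightarrow> 'u measure \<Rightarrow> (nat \<Rightarrow> 'v measure) \<Rightarrow>
     (nat \<Rightarrow> 'u \<Rightarrow> 'v \<Rightarrow> (nat \<Rightarrow> 'y) \<Rightarrow> 'x \<Rightarrow> 'y \<Rightarrow> real) \<Rightarrow> 'x measure \<Rightarrow>
     (nat \<Rightarrow> 'y) measure" where
  "output_law \<mu> n PU PV G P = distr (transcript_law \<mu> n PU PV G P) (PiM {..<n} (\<lambda>_. \<mu>)) fst"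

text \<open>For a family \<open>L z\<close> of laws, the mixture of \<open>L Z\<close> conditionally on \<open>Z\<^sub>i = s\<close>, where \<open>Z\<close> is a
  \<open>\<tau>\<close>-biased Rademacher vector. The restriction to the support is needed because \<^const>\<open>bind\<close>
  requires the kernel to be well-behaved on the whole space, but \<open>L z\<close> is meaningful only for
  \<open>z\<close> in the cube.\<close>

definition conditional_mixture ::
    "real \<Rightarrow> nat \<Rightarrow> nat \<Rightarrow> int \<Rightarrow> ((nat \<Rightarrow> int) \<Rightarrow> 'a measure) \<Rightarrow> 'a measure" where
  "conditional_mixture \<tau> k i s L =
     (let D = cond_pmf (rad_cube \<tau> k) {z. z i = s}
      in restrict_space (measure_pmf D) (set_pmf D) \<bind> L)"

end

theory Submission
  imports Defs
begin

text \<open>For a fixed coordinate \<open>i\<close> and fixed randomness, let \<open>p\<close> and \<open>q\<close> be the densities of the transcript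
  for the inputs \<open>p\<^sub>z\<close> and \<open>p\<^sub>z\<^sub>\<oplus>\<^sub>i\<close>. The triangular discrimination \<open>\<integral>(p - q)\<^sup>2 / (p + q)\<close>
  is at least twice the squared total variation distance, and appending a message with conditional densities
  \<open>g\<close>, \<open>h\<close> increases it by at most \<open>4 \<integral>(h - g)\<^sup>2 / g\<close>, averaged over the past under \<open>p\<close> alone. The past
  therefore does not depend on \<open>i\<close>, so these increments can be summed over \<open>i\<close> for one and the same channel:
  Bessel's inequality bounds the sum by the variance, the Donsker-Varadhan inequality for the subgaussian
  vector \<open>\<phi>\<close> bounds it by the mutual information. This replaces the Hellinger argument and gives the
  constant \<open>2\<close> in place of \<open>7\<close>. Averaging over \<open>z\<close> and the randomness is harmless because the
  bound holds pointwise.\<close>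

section \<open>Triangular discrimination of sequentially generated densities\<close>

text \<open>The potential is convex in the likelihood ratio, so passing from \<open>g\<close> to
  \<open>h\<close> in one round costs a linear term plus a remainder. The linear term integrates to
  zero because \<open>g\<close> and \<open>h\<close> have the same mass; only the remainder, of
  order (h - g)^2 / g, survives. This is why no absolute continuity between whole transcripts enters
  and why errors add up over the rounds instead of multiplying. All randomness is fixed, the private
  seeds included. The input of a round is then independent of the past messages, so the conditional
  density of a message is the mean of one channel of the round over p_z, or over the flipped
  distribution. Constants: each round adds 4 and total variation squared is at most half the
  discrimination, which leaves 2; Cauchy-Schwarz over the k coordinates turns the squared mean into
  1/k times the sum of squares. For a fixed output the transport inequality is applied to the
  posterior of the input; it costs 2 \<sigma>^2 times a divergence in nats, hence an extra 2 ln 2 in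
  bits.\<close>

lemma nn_integral_PiM_Suc:
  assumes "sigma_finite_measure \<mu>" "f \<in> borel_measurable (PiM {..<Suc t} (\<lambda>_. \<mu>))"
  shows "(\<integral>\<^sup>+ys. f ys \<partial>PiM {..<Suc t} (\<lambda>_. \<mu>)) =
    (\<integral>\<^sup>+ys. \<integral>\<^sup>+y. f (ys(t := y)) \<partial>\<mu> \<partial>PiM {..<t} (\<lambda>_. \<mu>))"
proof -
  interpret sigma_finite_measure \<mu> by fact
  interpret product_sigma_finite "\<lambda>_::nat. \<mu>" by unfold_locales
  show ?thesis
    using product_nn_integral_insert[of "{..<t}" t f] assms(2) by (simp add: lessThan_Suc)
qed

text \<open>The chain rule for a joint density. The past is passed as a restriction because the
  conditional densities are controlled only on the product space over \<open>{..<s}\<close>, whose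
  points are \<open>undefined\<close> outside the index set.\<close>

definition path_density :: "(nat \<Rightarrow> (nat \<Rightarrow> 'y) \<Rightarrow> 'y \<Rightarrow> real) \<Rightarrow> nat \<Rightarrow> (nat \<Rightarrow> 'y) \<Rightarrow> real" where
  "path_density g t ys = (\<Prod>s<t. g s (restrict ys {..<s}) (ys s))"

lemma path_density_0 [simp]: "path_density g 0 ys = 1"
  by (simp add: path_density_def)

lemma path_density_upd:
  assumes "ys \<in> extensional {..<t}"
  shows "path_density g (Suc t) (ys(t := y)) = path_density g t ys * g t ys y"
proof -
  have *: "restrict (ys(t := y)) {..<s} = restrict ys {..<s}" if "s \<le> t" for s
    using that by (auto simp: restrict_def)
  have "restrict ys {..<t} = ys"
    using assms by (simp add: extensional_restrict)
  then show ?thesis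
    by (simp add: path_density_def *)
qed

text \<open>Division in \<open>ennreal\<close> makes the integrand 0 where both densities vanish and
  infinite where only \<open>g\<close> does. With this convention \<open>triangular_step\<close>
  also holds at zeros of \<open>g\<close>.\<close>

definition chi_square :: "'y measure \<Rightarrow> ('y \<Rightarrow> real) \<Rightarrow> ('y \<Rightarrow> real) \<Rightarrow> ennreal" where
  "chi_square \<mu> g h = (\<integral>\<^sup>+y. ennreal ((h y - g y)\<^sup>2) / ennreal (g y) \<partial>\<mu>)"

section \<open>Densities of sequentially generated messages\<close>

locale conditional_densities = sigma_finite_measure \<mu>
  for \<mu> :: "'y measure" +
  fixes n :: nat and g :: "nat \<Rightarrow> (nat \<Rightarrow> 'y) \<Rightarrow> 'y \<Rightarrow> real"
  assumes meas: "t < n \<Longrightarrow> (\<lambda>(ys, y). g t ys y) \<in> borel_measurable (PiM {..<t} (\<lambda>_. \<mu>) \<Otimes>\<^sub>M \<mu>)"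
    and nonneg: "t < n \<Longrightarrow> ys \<in> space (PiM {..<t} (\<lambda>_. \<mu>)) \<Longrightarrow> y \<in> space \<mu> \<Longrightarrow> 0 \<le> g t ys y"
    and mass: "t < n \<Longrightarrow> ys \<in> space (PiM {..<t} (\<lambda>_. \<mu>)) \<Longrightarrow> (\<integral>\<^sup>+y. ennreal (g t ys y) \<partial>\<mu>) = 1"
begin

lemma meas_section:
  assumes "t < n" "ys \<in> space (PiM {..<t} (\<lambda>_. \<mu>))"
  shows "g t ys \<in> borel_measurable \<mu>"
  using measurable_compose[OF measurable_Pair1'[OF assms(2)] meas[OF assms(1)]] by simp

lemma path_density_measurable [measurable]:
  assumes "t \<le> n"
  shows "path_density g t \<in> borel_measurable (PiM {..<t} (\<lambda>_. \<mu>))"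
proof -
  have "(\<lambda>ys. g s (restrict ys {..<s}) (ys s)) \<in> borel_measurable (PiM {..<t} (\<lambda>_. \<mu>))"
    if "s < t" for s
  proof -
    have "(\<lambda>ys. (restrict ys {..<s}, ys s)) \<in> PiM {..<t} (\<lambda>_. \<mu>) \<rightarrow>\<^sub>M PiM {..<s} (\<lambda>_. \<mu>) \<Otimes>\<^sub>M \<mu>"
      using that by (intro measurable_Pair measurable_restrict_subset measurable_component_singleton) auto
    from measurable_compose[OF this meas[of s]] that assms show ?thesis
      by simp
  qed
  then show ?thesis
    unfolding path_density_def[abs_def] by (intro borel_measurable_prod) auto
qed

lemma path_density_nonneg:
  assumes "t \<le> n" "ys \<in> space (PiM {..<t} (\<lambda>_. \<mu>))"
  shows "0 \<le> path_density g t ys"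
  unfolding path_density_def
proof (intro prod_nonneg ballI)
  fix s assume "s \<in> {..<t}"
  with assms show "0 \<le> g s (restrict ys {..<s}) (ys s)"
    by (intro nonneg) (auto simp: space_PiM PiE_iff)
qed

text \<open>The test function \<open>F\<close> serves two purposes: \<open>F = 1\<close> gives the
  total mass, and a general \<open>F\<close> is what the identification of the law of the messages
  needs.\<close>

lemma nn_integral_path_density_Suc:
  assumes t: "t < n" and F: "F \<in> borel_measurable (PiM {..<Suc t} (\<lambda>_. \<mu>))"
  shows "(\<integral>\<^sup>+ys. ennreal (path_density g (Suc t) ys) * F ys \<partial>PiM {..<Suc t} (\<lambda>_. \<mu>)) =
    (\<integral>\<^sup>+ys. ennreal (path_density g t ys) * (\<integral>\<^sup>+y. ennreal (g t ys y) * F (ys(t := y)) \<partial>\<mu>)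
      \<partial>PiM {..<t} (\<lambda>_. \<mu>))"
proof -
  have [measurable]: "path_density g (Suc t) \<in> borel_measurable (PiM {..<Suc t} (\<lambda>_. \<mu>))"
    using t by simp
  note F[measurable]
  have "(\<integral>\<^sup>+ys. ennreal (path_density g (Suc t) ys) * F ys \<partial>PiM {..<Suc t} (\<lambda>_. \<mu>)) =
    (\<integral>\<^sup>+ys. \<integral>\<^sup>+y. ennreal (path_density g (Suc t) (ys(t := y))) * F (ys(t := y)) \<partial>\<mu> \<partial>PiM {..<t} (\<lambda>_. \<mu>))"
    by (subst nn_integral_PiM_Suc) (use sigma_finite_measure_axioms in auto)
  also have "\<dots> = (\<integral>\<^sup>+ys. ennreal (path_density g t ys) * (\<integral>\<^sup>+y. ennreal (g t ys y) * F (ys(t := y)) \<partial>\<mu>)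
      \<partial>PiM {..<t} (\<lambda>_. \<mu>))"
  proof (intro nn_integral_cong)
    fix ys assume ys: "ys \<in> space (PiM {..<t} (\<lambda>_. \<mu>))"
    have [measurable]: "g t ys \<in> borel_measurable \<mu>"
      by (rule meas_section[OF t ys])
    have "(\<lambda>y. ys(t := y)) \<in> \<mu> \<rightarrow>\<^sub>M PiM {..<Suc t} (\<lambda>_. \<mu>)"
      using measurable_fun_upd[of "{..<Suc t}" "{..<t}" t "\<lambda>_. ys" \<mu> "\<lambda>_. \<mu>" "\<lambda>y. y"] ys
      by (auto simp: lessThan_Suc)
    from measurable_compose[OF this F] have [measurable]: "(\<lambda>y. F (ys(t := y))) \<in> borel_measurable \<mu>" .
    have "(\<integral>\<^sup>+y. ennreal (path_density g (Suc t) (ys(t := y))) * F (ys(t := y)) \<partial>\<mu>) =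
      (\<integral>\<^sup>+y. ennreal (path_density g t ys) * (ennreal (g t ys y) * F (ys(t := y))) \<partial>\<mu>)"
    proof (intro nn_integral_cong)
      fix y assume "y \<in> space \<mu>"
      have "ys \<in> extensional {..<t}" using ys by (auto simp: space_PiM PiE_iff)
      with t ys \<open>y \<in> space \<mu>\<close> show "ennreal (path_density g (Suc t) (ys(t := y))) * F (ys(t := y)) =
          ennreal (path_density g t ys) * (ennreal (g t ys y) * F (ys(t := y)))"
        by (simp add: path_density_upd ennreal_mult path_density_nonneg nonneg mult.assoc)
    qed
    also have "\<dots> = ennreal (path_density g t ys) * (\<integral>\<^sup>+y. ennreal (g t ys y) * F (ys(t := y)) \<partial>\<mu>)"
      by (rule nn_integral_cmult) simp
    finally show "(\<integral>\<^sup>+y. ennreal (path_density g (Suc t) (ys(t := y))) * F (ys(t := y)) \<partial>\<mu>) =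
       ennreal (path_density g t ys) * (\<integral>\<^sup>+y. ennreal (g t ys y) * F (ys(t := y)) \<partial>\<mu>)" .
  qed
  finally show ?thesis .
qed

lemma path_density_mass:
  "t \<le> n \<Longrightarrow> (\<integral>\<^sup>+ys. ennreal (path_density g t ys) \<partial>PiM {..<t} (\<lambda>_. \<mu>)) = 1"
proof (induction t)
  case 0
  show ?case
    by (simp add: PiM_empty)
next
  case (Suc t)
  have "(\<integral>\<^sup>+ys. ennreal (path_density g (Suc t) ys) \<partial>PiM {..<Suc t} (\<lambda>_. \<mu>)) =
    (\<integral>\<^sup>+ys. ennreal (path_density g t ys) * (\<integral>\<^sup>+y. ennreal (g t ys y) \<partial>\<mu>) \<partial>PiM {..<t} (\<lambda>_. \<mu>))"
    using nn_integral_path_density_Suc[of t "\<lambda>_. 1"] Suc by simp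
  also have "\<dots> = (\<integral>\<^sup>+ys. ennreal (path_density g t ys) \<partial>PiM {..<t} (\<lambda>_. \<mu>))"
    using Suc.prems by (intro nn_integral_cong) (simp add: mass)
  finally show ?case using Suc by simp
qed

end

text \<open>For fixed p, q, g the map h |-> (p g)^2 / (p g + q h) has at h = g the value p^2 g / (p
  + q) and the slope - p^2 q / (p + q)^2. Its distance from this tangent is exactly p^2 q^2 (h -
  g)^2 / ((p g + q h) (p + q)^2), and p g + q h \<ge> p g together with q \<le> p + q bounds that by
  p (h - g)^2 / g. The slope term is split over the two sides so that every summand is non-negative
  in \<open>ennreal\<close>.\<close>

lemma triangular_step:
  fixes p q g h :: real
  assumes "0 \<le> p" "0 \<le> q" "0 \<le> g" "0 \<le> h"
  shows "ennreal ((p * g)\<^sup>2 / (p * g + q * h)) + ennreal (p\<^sup>2 * q / (p + q)\<^sup>2) * ennreal h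
    \<le> ennreal (p\<^sup>2 / (p + q)) * ennreal g + ennreal (p\<^sup>2 * q / (p + q)\<^sup>2) * ennreal g
      + ennreal p * (ennreal ((h - g)\<^sup>2) / ennreal g)"
proof (cases "p = 0 \<or> g = 0")
  case True
  then consider "p = 0" | "p > 0" "g = 0" "h = 0" | "p > 0" "g = 0" "h > 0"
    using assms by fastforce
  then show ?thesis
  proof cases
    \<comment> \<open>A past of positive density under p is followed by a message that only
      \<open>h\<close> allows: the right side is infinite.\<close>
    case 3
    then have "ennreal p * (ennreal ((h - g)\<^sup>2) / ennreal g) = \<infinity>"
      by (simp add: ennreal_divide_zero ennreal_mult_eq_top_iff)
    then show ?thesis by simp
  qed auto
next
  case False
  then have pos: "p > 0" "g > 0" using assms by auto
  have pq: "p + q > 0" "p * g + q * h > 0" using pos assms by (auto intro: add_pos_nonneg)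
  define D s where "D = p * g + q * h" and "s = p + q"
  have D: "D > 0" and s: "s > 0" using pq by (auto simp: D_def s_def)
  have "(p * g)\<^sup>2 / D - p\<^sup>2 / s * g = p\<^sup>2 * g * (g * s - D) / (D * s)"
    using D s by (simp add: field_simps power2_eq_square)
  also have "g * s - D = q * (g - h)"
    by (simp add: D_def s_def algebra_simps)
  finally have 1: "(p * g)\<^sup>2 / D - p\<^sup>2 / s * g = p\<^sup>2 * g * (q * (g - h)) / (D * s)" .
  have "p\<^sup>2 * g * (q * (g - h)) / (D * s) - p\<^sup>2 * q / s\<^sup>2 * (g - h)
      = p\<^sup>2 * q * (g - h) * (g * s - D) / (D * s\<^sup>2)"
    using D s by (simp add: field_simps power2_eq_square)
  also have "g * s - D = q * (g - h)"
    by (simp add: D_def s_def algebra_simps)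
  finally have **: "p\<^sup>2 * g * (q * (g - h)) / (D * s) - p\<^sup>2 * q / s\<^sup>2 * (g - h)
      = p\<^sup>2 * q * (g - h) * (q * (g - h)) / (D * s\<^sup>2)" .
  have *: "p\<^sup>2 * q * (g - h) * (q * (g - h)) = p * q\<^sup>2 * (p * (h - g)\<^sup>2)"
    by (simp add: power2_eq_square algebra_simps)
  \<comment> \<open>The remainder is written as a product whose factors are bounded separately: the
    first by p since q \<le> s, the second by p (h - g)^2 / (p g) since D \<ge> p g.\<close>
  have 2: "p\<^sup>2 * g * (q * (g - h)) / (D * s) - p\<^sup>2 * q / s\<^sup>2 * (g - h)
      = (p * (q / s)\<^sup>2) * (p * (h - g)\<^sup>2 / D)"
    unfolding ** * by (simp add: power_divide mult.commute[of D])
  have "(q / s)\<^sup>2 \<le> 1"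
    using assms pos by (simp add: s_def abs_square_le_1)
  then have "p * (q / s)\<^sup>2 \<le> p * 1"
    using pos by (intro mult_left_mono) auto
  moreover have "p * (h - g)\<^sup>2 / D \<le> p * (h - g)\<^sup>2 / (p * g)"
    using assms pos D by (intro divide_left_mono) (auto simp: D_def)
  ultimately have "(p * (q / s)\<^sup>2) * (p * (h - g)\<^sup>2 / D) \<le> (p * 1) * (p * (h - g)\<^sup>2 / (p * g))"
    using pos D by (intro mult_mono) auto
  also have "\<dots> = p * ((h - g)\<^sup>2 / g)"
    using pos by simp
  finally have 3: "(p * (q / s)\<^sup>2) * (p * (h - g)\<^sup>2 / D) \<le> p * ((h - g)\<^sup>2 / g)" .
  have main: "(p * g)\<^sup>2 / (p * g + q * h) + p\<^sup>2 * q / (p + q)\<^sup>2 * h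
    \<le> p\<^sup>2 / (p + q) * g + p\<^sup>2 * q / (p + q)\<^sup>2 * g + p * ((h - g)\<^sup>2 / g)"
    using 1 2 3 right_diff_distrib[of "p\<^sup>2 * q / s\<^sup>2" g h]
    unfolding D_def[symmetric] s_def[symmetric] by linarith
  have "ennreal ((p * g)\<^sup>2 / (p * g + q * h)) + ennreal (p\<^sup>2 * q / (p + q)\<^sup>2) * ennreal h
    = ennreal ((p * g)\<^sup>2 / (p * g + q * h) + p\<^sup>2 * q / (p + q)\<^sup>2 * h)"
    using assms by (simp add: ennreal_mult del: times_divide_eq_left times_divide_eq_right)
  also have "\<dots> \<le> ennreal (p\<^sup>2 / (p + q) * g + p\<^sup>2 * q / (p + q)\<^sup>2 * g + p * ((h - g)\<^sup>2 / g))"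
    using main by (rule ennreal_leI)
  also have "\<dots> = ennreal (p\<^sup>2 / (p + q)) * ennreal g + ennreal (p\<^sup>2 * q / (p + q)\<^sup>2) * ennreal g
      + ennreal p * (ennreal ((h - g)\<^sup>2) / ennreal g)"
    using assms pos
    by (simp add: ennreal_mult divide_ennreal del: times_divide_eq_left times_divide_eq_right)
  finally show ?thesis .
qed


text \<open>The square of l c (p + q) - (p - q), divided by p + q, is non-negative. Rewriting (p -
  q)^2 / (p + q) as 4 p^2 / (p + q) - 3 p + q leaves the potential as the only term that is not
  linear in p and q, so the inequality can be integrated against a sign c and the number l chosen
  afterwards.\<close>

lemma triangular_duality:
  fixes p q c l :: real
  assumes "0 \<le> p" "0 \<le> q" "\<bar>c\<bar> \<le> 1"
  shows "2 * l * c * (p - q) + 3 * p \<le> l\<^sup>2 * (p + q) + 4 * (p\<^sup>2 / (p + q)) + q"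
proof (cases "p + q = 0")
  case True
  then show ?thesis using assms by (simp add: add_nonneg_eq_0_iff)
next
  case False
  then have s: "p + q > 0" using assms by auto
  have "0 \<le> (l * c * (p + q) - (p - q))\<^sup>2 / (p + q)"
    using s by simp
  also have "\<dots> = (l * c)\<^sup>2 * (p + q) - 2 * l * c * (p - q) + (p - q)\<^sup>2 / (p + q)"
    using s by (simp add: field_simps power2_eq_square)
  also have "(p - q)\<^sup>2 / (p + q) = 4 * (p\<^sup>2 / (p + q)) - 3 * p + q"
    using s by (simp add: field_simps power2_eq_square)
  finally have 1: "2 * l * c * (p - q) + 3 * p \<le> (l * c)\<^sup>2 * (p + q) + 4 * (p\<^sup>2 / (p + q)) + q"
    by simp
  have "c\<^sup>2 \<le> 1" using assms by (simp add: abs_square_le_1)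
  then have "(l * c)\<^sup>2 \<le> l\<^sup>2"
    by (simp add: power_mult_distrib mult_left_le)
  then have "(l * c)\<^sup>2 * (p + q) \<le> l\<^sup>2 * (p + q)"
    using s by (intro mult_right_mono) auto
  with 1 show ?thesis by simp
qed

text \<open>For densities of mass one the triangular discrimination is 4 times the integral on the
  right minus 2, so this says that the squared difference is at most half of it. The 1 stands on the
  left to avoid subtraction in \<open>ennreal\<close>.\<close>

lemma triangular_TV_bound:
  fixes p q :: "'a \<Rightarrow> real"
  assumes [measurable]: "p \<in> borel_measurable M" "q \<in> borel_measurable M" and A [measurable]: "A \<in> sets M"
    and nonneg: "\<And>x. x \<in> space M \<Longrightarrow> 0 \<le> p x" "\<And>x. x \<in> space M \<Longrightarrow> 0 \<le> q x"
    and mass: "(\<integral>\<^sup>+x. ennreal (p x) \<partial>M) = 1" "(\<integral>\<^sup>+x. ennreal (q x) \<partial>M) = 1"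
  shows "ennreal ((measure (density M p) A - measure (density M q) A)\<^sup>2) + 1
    \<le> 2 * (\<integral>\<^sup>+x. ennreal ((p x)\<^sup>2 / (p x + q x)) \<partial>M)"
proof -
  have int: "integrable M p" "integrable M q"
    using mass nonneg by (auto intro!: integrableI_nonneg AE_I2)
  have I: "(\<integral>x. p x \<partial>M) = 1" "(\<integral>x. q x \<partial>M) = 1"
    using mass nonneg by (auto simp: integral_eq_nn_integral AE_I2)
  have meas_density: "measure (density M f) A = (\<integral>x. indicator A x * f x \<partial>M)"
    if [measurable]: "f \<in> borel_measurable M" and nn: "\<And>x. x \<in> space M \<Longrightarrow> 0 \<le> f x"
    for f :: "'a \<Rightarrow> real"
  proof -
    have "emeasure (density M f) A = (\<integral>\<^sup>+x. ennreal (indicator A x * f x) \<partial>M)"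
      by (simp add: emeasure_density) (auto intro!: nn_integral_cong split: split_indicator)
    moreover have "(\<integral>x. indicator A x * f x \<partial>M) = enn2real (\<integral>\<^sup>+x. ennreal (indicator A x * f x) \<partial>M)"
      using nn by (intro integral_eq_nn_integral) (auto intro!: AE_I2)
    ultimately show ?thesis by (simp add: measure_def)
  qed
  \<comment> \<open>A sign instead of an indicator: since p and q have the same mass, the integral
    of w (p - q) is twice the difference of the measures of \<open>A\<close>.\<close>
  define w where "w x = (if x \<in> A then 1 else -1 :: real)" for x
  have [measurable]: "w \<in> borel_measurable M"
    unfolding w_def by measurable
  define r where "r x = (p x)\<^sup>2 / (p x + q x)" for x
  have [measurable]: "r \<in> borel_measurable M"
    unfolding r_def by measurable
  have r: "0 \<le> r x" "r x \<le> p x" if "x \<in> space M" for x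
  proof -
    show "0 \<le> r x" using nonneg[OF that] by (simp add: r_def)
    show "r x \<le> p x"
      using nonneg[OF that] unfolding r_def
      by (cases "p x + q x = 0") (auto simp: power2_eq_square divide_simps intro!: mult_left_mono)
  qed
  have int_r: "integrable M r"
    by (rule Bochner_Integration.integrable_bound[OF int(1)]) (use r nonneg in \<open>auto intro!: AE_I2\<close>)
  have int_w: "integrable M (\<lambda>x. w x * f x)" if "integrable M f" for f :: "'a \<Rightarrow> real"
    by (rule Bochner_Integration.integrable_bound[OF that]) (use that in \<open>auto simp: w_def\<close>)
  have int_A: "integrable M (\<lambda>x. indicator A x * f x)" if "integrable M f" for f :: "'a \<Rightarrow> real"
    by (rule Bochner_Integration.integrable_bound[OF that]) (use that in \<open>auto simp: indicator_def\<close>)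
  define d where "d = measure (density M p) A - measure (density M q) A"
  have w_eq: "w x * f x = 2 * (indicator A x * f x) - f x" for f :: "'a \<Rightarrow> real" and x
    by (simp add: w_def indicator_def)
  have "2 * d = (\<integral>x. w x * p x \<partial>M) - (\<integral>x. w x * q x \<partial>M)"
    unfolding d_def using int I by (simp add: meas_density nonneg w_eq int_A)
  \<comment> \<open>The duality is used with l = d, the maximiser of 4 l d - 2 l^2.\<close>
  have "(\<integral>x. (2 * d * (w x * p x) - 2 * d * (w x * q x)) + 3 * p x \<partial>M)
      \<le> (\<integral>x. (d\<^sup>2 * p x + d\<^sup>2 * q x) + 4 * r x + q x \<partial>M)"
  proof (rule integral_mono)
    fix x assume "x \<in> space M"
    then show "(2 * d * (w x * p x) - 2 * d * (w x * q x)) + 3 * p x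
        \<le> (d\<^sup>2 * p x + d\<^sup>2 * q x) + 4 * r x + q x"
      using triangular_duality[of "p x" "q x" "w x" d] nonneg
      by (simp add: w_def r_def algebra_simps)
  qed (intro Bochner_Integration.integrable_add Bochner_Integration.integrable_diff integrable_mult_right int int_r int_w)+
  then have "2 * d * ((\<integral>x. w x * p x \<partial>M) - (\<integral>x. w x * q x \<partial>M)) + 3
      \<le> 2 * d\<^sup>2 + 4 * (\<integral>x. r x \<partial>M) + 1"
    using int int_r int_w[OF int(1)] int_w[OF int(2)] I by (simp add: right_diff_distrib)
  then have "d\<^sup>2 + 1 \<le> 2 * (\<integral>x. r x \<partial>M)"
    unfolding \<open>2 * d = _\<close>[symmetric] by (simp add: power2_eq_square)
  then have "ennreal (d\<^sup>2 + 1) \<le> ennreal (2 * (\<integral>x. r x \<partial>M))"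
    by (rule ennreal_leI)
  also have "\<dots> = 2 * (\<integral>\<^sup>+x. ennreal (r x) \<partial>M)"
    using r int_r by (simp add: nn_integral_eq_integral ennreal_mult')
  finally show ?thesis
    by (simp add: d_def r_def)
qed

text \<open>The potential is the \<open>f\<close>-divergence with \<open>f x = 1 / (1 + x)\<close>, an affine image of the
  triangular discrimination. The step works because \<open>x\<^sup>2 f'' x\<close> is bounded, which fails for the
  chi-square divergence.\<close>

lemma triangular_potential_bound:
  assumes g: "conditional_densities \<mu> n g" and h: "conditional_densities \<mu> n h" and "t \<le> n"
  shows "(\<integral>\<^sup>+ys. ennreal ((path_density g t ys)\<^sup>2 / (path_density g t ys + path_density h t ys))
      \<partial>PiM {..<t} (\<lambda>_. \<mu>))
    \<le> 1 / 2 + (\<Sum>s<t. \<integral>\<^sup>+ys. ennreal (path_density g s ys) * chi_square \<mu> (g s ys) (h s ys)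
      \<partial>PiM {..<s} (\<lambda>_. \<mu>))"
  using \<open>t \<le> n\<close>
proof (induction t)
  case 0
  show ?case
    using divide_ennreal[of 1 2] by (simp add: PiM_empty)
next
  case (Suc t)
  interpret g: conditional_densities \<mu> n g by fact
  interpret h: conditional_densities \<mu> n h by fact
  let ?M = "\<lambda>t. PiM {..<t} (\<lambda>_. \<mu>)"
  have t: "t < n" "t \<le> n" using Suc.prems by auto
  have [measurable]: "path_density g t \<in> borel_measurable (?M t)" "path_density h t \<in> borel_measurable (?M t)"
    "path_density g (Suc t) \<in> borel_measurable (?M (Suc t))" "path_density h (Suc t) \<in> borel_measurable (?M (Suc t))"
    using Suc.prems by auto
  define r where "r t ys = (path_density g t ys)\<^sup>2 / (path_density g t ys + path_density h t ys)" for t ys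
  have [measurable]: "r t \<in> borel_measurable (?M t)" "r (Suc t) \<in> borel_measurable (?M (Suc t))"
    unfolding r_def by measurable
  have [measurable]: "(\<lambda>(ys, y). g t ys y) \<in> borel_measurable (?M t \<Otimes>\<^sub>M \<mu>)"
      "(\<lambda>(ys, y). h t ys y) \<in> borel_measurable (?M t \<Otimes>\<^sub>M \<mu>)"
    using g.meas h.meas t by auto
  have "(\<integral>\<^sup>+ys. ennreal (r (Suc t) ys) \<partial>?M (Suc t))
      = (\<integral>\<^sup>+ys. \<integral>\<^sup>+y. ennreal (r (Suc t) (ys(t := y))) \<partial>\<mu> \<partial>?M t)"
    by (rule nn_integral_PiM_Suc) (auto simp: g.sigma_finite_measure_axioms)
  also have "\<dots> \<le> (\<integral>\<^sup>+ys. ennreal (r t ys) + ennreal (path_density g t ys) * chi_square \<mu> (g t ys) (h t ys) \<partial>?M t)"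
  proof (rule nn_integral_mono)
    fix ys assume ys: "ys \<in> space (?M t)"
    have [measurable]: "g t ys \<in> borel_measurable \<mu>" "h t ys \<in> borel_measurable \<mu>"
      using g.meas_section[OF t(1) ys] h.meas_section[OF t(1) ys] by auto
    have ext: "ys \<in> extensional {..<t}" using ys by (auto simp: space_PiM PiE_iff)
    define p q where "p = path_density g t ys" and "q = path_density h t ys"
    have pq: "0 \<le> p" "0 \<le> q"
      using g.path_density_nonneg[OF t(2) ys] h.path_density_nonneg[OF t(2) ys] by (auto simp: p_def q_def)
    \<comment> \<open>The slope of the tangent in \<open>triangular_step\<close>. It is finite and
      constant in the new message, and \<open>h\<close> and \<open>g\<close> both have mass one, so
      it contributes \<open>C\<close> to each side and can be cancelled at the end.\<close>
    define C where "C = ennreal (p\<^sup>2 * q / (p + q)\<^sup>2)"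
    have "(\<lambda>y. ys(t := y)) \<in> \<mu> \<rightarrow>\<^sub>M ?M (Suc t)"
      using measurable_fun_upd[of "{..<Suc t}" "{..<t}" t "\<lambda>_. ys" \<mu> "\<lambda>_. \<mu>" "\<lambda>y. y"] ys
      by (auto simp: lessThan_Suc)
    from measurable_compose[OF this, of "r (Suc t)"]
    have [measurable]: "(\<lambda>y. r (Suc t) (ys(t := y))) \<in> borel_measurable \<mu>"
      by simp
    have "(\<integral>\<^sup>+y. ennreal (r (Suc t) (ys(t := y))) \<partial>\<mu>) + C
        = (\<integral>\<^sup>+y. ennreal (r (Suc t) (ys(t := y))) + C * ennreal (h t ys y) \<partial>\<mu>)"
      using h.mass[OF t(1) ys] by (simp add: nn_integral_add nn_integral_cmult)
    also have "\<dots> \<le> (\<integral>\<^sup>+y. ennreal (p\<^sup>2 / (p + q)) * ennreal (g t ys y) + C * ennreal (g t ys y)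
        + ennreal p * (ennreal ((h t ys y - g t ys y)\<^sup>2) / ennreal (g t ys y)) \<partial>\<mu>)"
    proof (rule nn_integral_mono)
      fix y assume y: "y \<in> space \<mu>"
      show "ennreal (r (Suc t) (ys(t := y))) + C * ennreal (h t ys y)
        \<le> ennreal (p\<^sup>2 / (p + q)) * ennreal (g t ys y) + C * ennreal (g t ys y)
          + ennreal p * (ennreal ((h t ys y - g t ys y)\<^sup>2) / ennreal (g t ys y))"
        using triangular_step[OF pq g.nonneg[OF t(1) ys y] h.nonneg[OF t(1) ys y]]
        by (simp add: r_def path_density_upd[OF ext] C_def p_def q_def)
    qed
    also have "\<dots> = ennreal (p\<^sup>2 / (p + q)) + C + ennreal p * chi_square \<mu> (g t ys) (h t ys)"
      using g.mass[OF t(1) ys] unfolding chi_square_def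
      by (simp add: nn_integral_add nn_integral_cmult)
    finally have "C + (\<integral>\<^sup>+y. ennreal (r (Suc t) (ys(t := y))) \<partial>\<mu>)
        \<le> C + (ennreal (p\<^sup>2 / (p + q)) + ennreal p * chi_square \<mu> (g t ys) (h t ys))"
      by (simp add: ac_simps)
    then show "(\<integral>\<^sup>+y. ennreal (r (Suc t) (ys(t := y))) \<partial>\<mu>)
        \<le> ennreal (r t ys) + ennreal (path_density g t ys) * chi_square \<mu> (g t ys) (h t ys)"
      unfolding r_def p_def q_def C_def by (simp add: ennreal_add_left_cancel_le)
  qed
  also have "\<dots> = (\<integral>\<^sup>+ys. ennreal (r t ys) \<partial>?M t)
      + (\<integral>\<^sup>+ys. ennreal (path_density g t ys) * chi_square \<mu> (g t ys) (h t ys) \<partial>?M t)"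
    unfolding chi_square_def by (intro nn_integral_add) measurable
  finally show ?case
    using Suc.IH[OF t(2)] by (auto simp: r_def add.assoc[symmetric] intro: order_trans[OF _ add_right_mono])
qed

text \<open>Doubling turns the initial value 1/2 of the potential into the 1 on the left of
  \<open>triangular_TV_bound\<close>; after cancellation only the increments of the rounds
  remain.\<close>

lemma path_density_TV_bound:
  assumes g: "conditional_densities \<mu> n g" and h: "conditional_densities \<mu> n h"
    and A: "A \<in> sets (PiM {..<n} (\<lambda>_. \<mu>))"
  shows "ennreal ((measure (density (PiM {..<n} (\<lambda>_. \<mu>)) (path_density g n)) A
      - measure (density (PiM {..<n} (\<lambda>_. \<mu>)) (path_density h n)) A)\<^sup>2)
    \<le> 2 * (\<Sum>t<n. \<integral>\<^sup>+ys. ennreal (path_density g t ys) * chi_square \<mu> (g t ys) (h t ys)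
      \<partial>PiM {..<t} (\<lambda>_. \<mu>))" (is "?d \<le> 2 * ?S")
proof -
  interpret g: conditional_densities \<mu> n g by fact
  interpret h: conditional_densities \<mu> n h by fact
  have "?d + 1 \<le> 2 * (\<integral>\<^sup>+ys. ennreal ((path_density g n ys)\<^sup>2 / (path_density g n ys + path_density h n ys))
      \<partial>PiM {..<n} (\<lambda>_. \<mu>))"
    using A by (intro triangular_TV_bound)
      (auto intro: g.path_density_nonneg h.path_density_nonneg simp: g.path_density_mass h.path_density_mass)
  also have "\<dots> \<le> 2 * (1 / 2 + ?S)"
    by (intro mult_left_mono triangular_potential_bound[OF g h]) auto
  also have "\<dots> = 1 + 2 * ?S"
    by (simp add: distrib_left ennreal_times_divide ennreal_divide_self)
  finally show ?thesis
    by (simp add: add.commute[of _ 1] ennreal_add_left_cancel_le)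
qed

section \<open>Messages for averaged inputs\<close>

lemma (in prob_space) prob_algebra_self: "M \<in> space (prob_algebra M)"
  using prob_space_axioms by (simp add: space_prob_algebra)

text \<open>A jointly measurable, normalised density is a Markov kernel in the sense of the Giry
  monad, which is the form that iterated \<open>bind\<close> requires.\<close>

lemma channel_kernel_prob_algebra:
  assumes \<mu>: "sigma_finite_measure \<mu>"
    and meas: "(\<lambda>(w, y). f w y) \<in> borel_measurable (N \<Otimes>\<^sub>M \<mu>)"
    and mass: "\<And>w. w \<in> space N \<Longrightarrow> (\<integral>\<^sup>+y. ennreal (f w y) \<partial>\<mu>) = 1"
  shows "(\<lambda>w. density \<mu> (\<lambda>y. ennreal (f w y))) \<in> N \<rightarrow>\<^sub>M prob_algebra \<mu>"
proof (rule measurable_prob_algebraI)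
  interpret sigma_finite_measure \<mu> by fact
  note meas [measurable]
  have sec [measurable]: "f w \<in> borel_measurable \<mu>" if "w \<in> space N" for w
    using measurable_compose[OF measurable_Pair1'[OF that] meas] by simp
  show prob: "prob_space (density \<mu> (\<lambda>y. ennreal (f w y)))" if "w \<in> space N" for w
    using mass[OF that] sec[OF that]
    by (intro prob_spaceI) (simp add: emeasure_density cong: nn_integral_cong)
  show "(\<lambda>w. density \<mu> (\<lambda>y. ennreal (f w y))) \<in> N \<rightarrow>\<^sub>M subprob_algebra \<mu>"
  proof (rule measurable_subprob_algebra)
    fix A assume [measurable]: "A \<in> sets \<mu>"
    have "(\<lambda>w. \<integral>\<^sup>+y. ennreal (f w y) * indicator A y \<partial>\<mu>) \<in> borel_measurable N"
      by measurable
    then show "(\<lambda>w. emeasure (density \<mu> (\<lambda>y. ennreal (f w y))) A) \<in> borel_measurable N"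
      by (rule measurable_cong[THEN iffD1, rotated]) (simp add: emeasure_density sec)
  qed (auto intro: prob prob_space_imp_subprob_space)
qed

locale protocol_setup =
  fixes X :: "'x measure" and \<mu> :: "'y measure" and n :: nat and \<W> :: "nat \<Rightarrow> ('x \<Rightarrow> 'y \<Rightarrow> real) set"
    and PU :: "'u measure" and PV :: "nat \<Rightarrow> 'v measure"
    and G :: "nat \<Rightarrow> 'u \<Rightarrow> 'v \<Rightarrow> (nat \<Rightarrow> 'y) \<Rightarrow> 'x \<Rightarrow> 'y \<Rightarrow> real"
  assumes \<mu>: "sigma_finite_measure \<mu>"
    and channels: "\<And>t V. t < n \<Longrightarrow> V \<in> \<W> t \<Longrightarrow> channel X \<mu> V"
    and protocol: "interactive_protocol X \<mu> n \<W> PU PV G"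
begin

lemma PU: "prob_space PU" and PV: "t < n \<Longrightarrow> prob_space (PV t)"
  using protocol by (auto simp: interactive_protocol_def)

lemma G_meas: "t < n \<Longrightarrow> (\<lambda>(u, v, ys, x, y). G t u v ys x y)
    \<in> borel_measurable (PU \<Otimes>\<^sub>M PV t \<Otimes>\<^sub>M PiM {..<t} (\<lambda>_. \<mu>) \<Otimes>\<^sub>M X \<Otimes>\<^sub>M \<mu>)"
  using protocol by (auto simp: interactive_protocol_def)

lemma G_channel:
  assumes "t < n" "u \<in> space PU" "v \<in> space (PV t)" "ys \<in> space (PiM {..<t} (\<lambda>_. \<mu>))"
  shows "G t u v ys \<in> \<W> t" "channel X \<mu> (G t u v ys)"
  using protocol channels assms by (auto simp: interactive_protocol_def)

lemma G_mass:
  assumes "t < n" "u \<in> space PU" "v \<in> space (PV t)" "ys \<in> space (PiM {..<t} (\<lambda>_. \<mu>))" "x \<in> space X"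
  shows "(\<integral>\<^sup>+y. ennreal (G t u v ys x y) \<partial>\<mu>) = 1"
  using G_channel[OF assms(1-4)] assms(5) by (auto simp: channel_def)

lemma measurable_channel_kernel_G:
  assumes t: "t < n"
    and [measurable]: "U \<in> N \<rightarrow>\<^sub>M PU" "V \<in> N \<rightarrow>\<^sub>M PV t" "ys \<in> N \<rightarrow>\<^sub>M PiM {..<t} (\<lambda>_. \<mu>)" "x \<in> N \<rightarrow>\<^sub>M X"
  shows "(\<lambda>w. channel_kernel \<mu> (G t (U w) (V w) (ys w)) (x w)) \<in> N \<rightarrow>\<^sub>M prob_algebra \<mu>"
  unfolding channel_kernel_def
proof (rule channel_kernel_prob_algebra[OF \<mu>])
  have "(\<lambda>(w, y). (U w, V w, ys w, x w, y)) \<in> N \<Otimes>\<^sub>M \<mu> \<rightarrow>\<^sub>M PU \<Otimes>\<^sub>M PV t \<Otimes>\<^sub>M PiM {..<t} (\<lambda>_. \<mu>) \<Otimes>\<^sub>M X \<Otimes>\<^sub>M \<mu>"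
    by measurable
  from measurable_compose[OF this G_meas[OF t]]
  show "(\<lambda>(w, y). G t (U w) (V w) (ys w) (x w) y) \<in> borel_measurable (N \<Otimes>\<^sub>M \<mu>)"
    by (simp add: case_prod_unfold)
  fix w assume "w \<in> space N"
  then show "(\<integral>\<^sup>+ y. ennreal (G t (U w) (V w) (ys w) (x w) y) \<partial>\<mu>) = 1"
    by (intro G_mass[OF t] assms(2-5)[THEN measurable_space])
qed

lemma measurable_append_message:
  assumes "ys \<in> N \<rightarrow>\<^sub>M PiM {..<t} (\<lambda>_. \<mu>)" "y \<in> N \<rightarrow>\<^sub>M \<mu>"
  shows "(\<lambda>w. (ys w)(t := y w)) \<in> N \<rightarrow>\<^sub>M PiM {..<Suc t} (\<lambda>_. \<mu>)"
  using measurable_fun_upd[of "{..<Suc t}" "{..<t}" t ys N "\<lambda>_. \<mu>" y] assms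
  by (auto simp: lessThan_Suc)

lemma measurable_message_step:
  assumes t: "t < n"
    and "U \<in> N \<rightarrow>\<^sub>M PU" "V \<in> N \<rightarrow>\<^sub>M PV t" "ys \<in> N \<rightarrow>\<^sub>M PiM {..<t} (\<lambda>_. \<mu>)" "x \<in> N \<rightarrow>\<^sub>M X"
  shows "(\<lambda>w. channel_kernel \<mu> (G t (U w) (V w) (ys w)) (x w) \<bind>
      (\<lambda>y. return (PiM {..<Suc t} (\<lambda>_. \<mu>)) ((ys w)(t := y)))) \<in> N \<rightarrow>\<^sub>M prob_algebra (PiM {..<Suc t} (\<lambda>_. \<mu>))"
proof (rule measurable_bind_prob_space2)
  show "(\<lambda>w. channel_kernel \<mu> (G t (U w) (V w) (ys w)) (x w)) \<in> N \<rightarrow>\<^sub>M prob_algebra \<mu>"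
    using assms by (rule measurable_channel_kernel_G)
  have "(\<lambda>wy. (ys (fst wy))(t := snd wy)) \<in> N \<Otimes>\<^sub>M \<mu> \<rightarrow>\<^sub>M PiM {..<Suc t} (\<lambda>_. \<mu>)"
    by (intro measurable_append_message measurable_compose[OF measurable_fst assms(4)] measurable_snd)
  from measurable_compose[OF this measurable_return_prob_space]
  show "(\<lambda>(w, y). return (PiM {..<Suc t} (\<lambda>_. \<mu>)) ((ys w)(t := y)))
      \<in> N \<Otimes>\<^sub>M \<mu> \<rightarrow>\<^sub>M prob_algebra (PiM {..<Suc t} (\<lambda>_. \<mu>))"
    by (simp add: case_prod_unfold)
qed

lemma measurable_messages_law:
  assumes "t \<le> n" and "U \<in> N \<rightarrow>\<^sub>M PU"
    and "\<And>s. s < t \<Longrightarrow> (\<lambda>w. vs w s) \<in> N \<rightarrow>\<^sub>M PV s" "\<And>s. s < t \<Longrightarrow> (\<lambda>w. xs w s) \<in> N \<rightarrow>\<^sub>M X"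
  shows "(\<lambda>w. messages_law \<mu> G t (U w) (vs w) (xs w)) \<in> N \<rightarrow>\<^sub>M prob_algebra (PiM {..<t} (\<lambda>_. \<mu>))"
  using assms
proof (induction t)
  case 0
  have "(\<lambda>w. \<lambda>_. undefined) \<in> N \<rightarrow>\<^sub>M PiM {..<0::nat} (\<lambda>_. \<mu>)"
    by (simp add: PiM_empty)
  from measurable_compose[OF this measurable_return_prob_space] show ?case
    by simp
next
  case (Suc t)
  have t: "t < n" using Suc.prems by simp
  have "(\<lambda>(w, ys). channel_kernel \<mu> (G t (U w) (vs w t) ys) (xs w t) \<bind>
      (\<lambda>y. return (PiM {..<Suc t} (\<lambda>_. \<mu>)) (ys(t := y))))
      \<in> N \<Otimes>\<^sub>M PiM {..<t} (\<lambda>_. \<mu>) \<rightarrow>\<^sub>M prob_algebra (PiM {..<Suc t} (\<lambda>_. \<mu>))"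
    unfolding case_prod_unfold
    by (intro measurable_message_step[OF t, of "\<lambda>z. U (fst z)" _ "\<lambda>z. vs (fst z) t" snd "\<lambda>z. xs (fst z) t"]
      measurable_snd measurable_compose[OF measurable_fst Suc.prems(2)]
      measurable_compose[OF measurable_fst Suc.prems(3)[OF lessI]]
      measurable_compose[OF measurable_fst Suc.prems(4)[OF lessI]])
  then show ?case
    unfolding messages_law.simps
    by (rule measurable_bind_prob_space2[rotated]) (use Suc in auto)
qed

end

text \<open>The first t messages look only at the inputs of the rounds before t. This makes the
  input of round t fresh when it is averaged out in \<open>nn_integral_messages_law\<close>.\<close>

lemma messages_law_cong:
  "(\<And>s. s < t \<Longrightarrow> xs s = xs' s) \<Longrightarrow> messages_law \<mu> G t u vs xs = messages_law \<mu> G t u vs xs'"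
  by (induction t) auto

text \<open>The value is \<open>0\<close> at the (null set of) messages
  where the channel is not integrable in the input.\<close>

definition mean_density :: "'x measure \<Rightarrow> ('x \<Rightarrow> 'y \<Rightarrow> real) \<Rightarrow> 'y \<Rightarrow> real" where
  "mean_density P V y = (\<integral>x. V x y \<partial>P)"

lemma channel_cong_sets:
  assumes "sets P = sets X"
  shows "channel P \<mu> V = channel X \<mu> V"
  unfolding channel_def
  by (simp only: measurable_cong_sets[OF sets_pair_measure_cong[OF assms refl] refl]
      sets_eq_imp_space_eq[OF assms])

section \<open>Averaging one channel over a random input\<close>

locale input_channel = prob_space P + sigma_finite_measure \<mu>
  for P :: "'x measure" and \<mu> :: "'y measure" and V :: "'x \<Rightarrow> 'y \<Rightarrow> real" +
  assumes channel: "channel P \<mu> V"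
begin

sublocale pair: pair_sigma_finite P \<mu> by unfold_locales

lemma V_meas [measurable]: "(\<lambda>(x, y). V x y) \<in> borel_measurable (P \<Otimes>\<^sub>M \<mu>)"
  and V_nonneg: "x \<in> space P \<Longrightarrow> y \<in> space \<mu> \<Longrightarrow> 0 \<le> V x y"
  and V_mass: "x \<in> space P \<Longrightarrow> (\<integral>\<^sup>+y. ennreal (V x y) \<partial>\<mu>) = 1"
  using channel by (auto simp: channel_def)

lemma V_meas1 [measurable]: "y \<in> space \<mu> \<Longrightarrow> (\<lambda>x. V x y) \<in> borel_measurable P"
  using measurable_compose[OF measurable_Pair2' V_meas] by simp

lemma V_meas2 [measurable]: "x \<in> space P \<Longrightarrow> V x \<in> borel_measurable \<mu>"
  using measurable_compose[OF measurable_Pair1' V_meas] by simp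

lemma nn_integral_V: "(\<integral>\<^sup>+y. \<integral>\<^sup>+x. ennreal (V x y) \<partial>P \<partial>\<mu>) = 1"
proof -
  have "(\<integral>\<^sup>+y. \<integral>\<^sup>+x. ennreal (V x y) \<partial>P \<partial>\<mu>) = (\<integral>\<^sup>+x. \<integral>\<^sup>+y. ennreal (V x y) \<partial>\<mu> \<partial>P)"
    by (rule pair.Fubini') measurable
  also have "\<dots> = (\<integral>\<^sup>+x. 1 \<partial>P)"
    by (intro nn_integral_cong) (rule V_mass)
  finally show ?thesis by (simp add: emeasure_space_1)
qed

text \<open>A channel is normalised in the output for every input, which says nothing about
  integrability in the input for a single output. By Tonelli the integral over both variables is
  one, so exceptions form a null set of outputs.\<close>

lemma AE_integrable_V: "AE y in \<mu>. integrable P (\<lambda>x. V x y)"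
proof -
  have "AE y in \<mu>. (\<integral>\<^sup>+x. ennreal (V x y) \<partial>P) \<noteq> \<infinity>"
    by (rule nn_integral_PInf_AE) (simp_all add: nn_integral_V)
  then show ?thesis
  proof (rule AE_mp, intro AE_I2 impI)
    fix y assume "y \<in> space \<mu>" "(\<integral>\<^sup>+x. ennreal (V x y) \<partial>P) \<noteq> \<infinity>"
    then show "integrable P (\<lambda>x. V x y)"
      by (intro integrableI_nonneg) (auto intro!: AE_I2 V_nonneg simp: less_top)
  qed
qed

lemma mean_density_nonneg: "y \<in> space \<mu> \<Longrightarrow> 0 \<le> mean_density P V y"
  unfolding mean_density_def by (intro integral_nonneg_AE AE_I2 V_nonneg)

lemma mean_density_meas [measurable]: "mean_density P V \<in> borel_measurable \<mu>"
  unfolding mean_density_def[abs_def] by measurable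

lemma AE_mean_density: "AE y in \<mu>. (\<integral>\<^sup>+x. ennreal (V x y) \<partial>P) = ennreal (mean_density P V y)"
  using AE_integrable_V
  by (rule AE_mp, intro AE_I2 impI)
     (auto simp: mean_density_def V_nonneg intro!: nn_integral_eq_integral AE_I2)

lemma mean_density_mass: "(\<integral>\<^sup>+y. ennreal (mean_density P V y) \<partial>\<mu>) = 1"
  using nn_integral_cong_AE[OF AE_mean_density] nn_integral_V by simp

end

section \<open>Averaging out the inputs for fixed randomness\<close>

context protocol_setup
begin

lemma input_channel_G:
  assumes "t < n" "u \<in> space PU" "v \<in> space (PV t)" "ys \<in> space (PiM {..<t} (\<lambda>_. \<mu>))"
    and P: "prob_space P" "sets P = sets X"
  shows "input_channel P \<mu> (G t u v ys)"
  by (intro input_channel.intro input_channel_axioms.intro P(1) \<mu>)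
     (simp only: channel_cong_sets[OF P(2)] G_channel(2)[OF assms(1-4)])

lemma conditional_densities_mean_density:
  assumes u: "u \<in> space PU" and vs: "\<And>t. t < n \<Longrightarrow> vs t \<in> space (PV t)"
    and P: "prob_space P" "sets P = sets X"
  shows "conditional_densities \<mu> n (\<lambda>t ys. mean_density P (G t u (vs t) ys))"
proof -
  interpret sigma_finite_measure \<mu> by (rule \<mu>)
  interpret P: prob_space P by fact
  show ?thesis
  proof
    fix t assume t: "t < n"
    let ?N = "PiM {..<t} (\<lambda>_. \<mu>)"
    have idX: "(\<lambda>x. x) \<in> P \<rightarrow>\<^sub>M X" using P(2) by simp
    have "(\<lambda>z. (u, vs t, fst (fst z), snd z, snd (fst z)))
        \<in> (?N \<Otimes>\<^sub>M \<mu>) \<Otimes>\<^sub>M P \<rightarrow>\<^sub>M PU \<Otimes>\<^sub>M PV t \<Otimes>\<^sub>M ?N \<Otimes>\<^sub>M X \<Otimes>\<^sub>M \<mu>"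
      by (intro measurable_Pair measurable_const u vs[OF t] measurable_compose[OF measurable_snd idX]
          measurable_compose[OF measurable_fst measurable_fst] measurable_compose[OF measurable_fst measurable_snd])
    from measurable_compose[OF this G_meas[OF t]]
    have "(\<lambda>(z, x). G t u (vs t) (fst z) x (snd z)) \<in> borel_measurable ((?N \<Otimes>\<^sub>M \<mu>) \<Otimes>\<^sub>M P)"
      by (simp add: case_prod_unfold)
    from P.borel_measurable_lebesgue_integral[OF this]
    show "(\<lambda>(ys, y). mean_density P (G t u (vs t) ys) y) \<in> borel_measurable (?N \<Otimes>\<^sub>M \<mu>)"
      by (simp add: mean_density_def case_prod_unfold)
    fix ys assume ys: "ys \<in> space ?N"
    interpret input_channel P \<mu> "G t u (vs t) ys"
      using input_channel_G[OF t u vs[OF t] ys P] .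
    show "(\<integral>\<^sup>+y. ennreal (mean_density P (G t u (vs t) ys) y) \<partial>\<mu>) = 1"
      by (rule mean_density_mass)
    show "0 \<le> mean_density P (G t u (vs t) ys) y" if "y \<in> space \<mu>" for y
      using that by (rule mean_density_nonneg)
  qed
qed

text \<open>For fixed randomness the input of the last round is independent of the earlier messages,
  so averaging over it replaces the channel by its mean density, and the means multiply along the
  path. The induction runs over all test functions because each step trades \<open>F\<close> for
  \<open>F\<close> integrated over the last input and message.\<close>

lemma nn_integral_messages_law:
  assumes u: "u \<in> space PU" and vs: "\<And>t. t < n \<Longrightarrow> vs t \<in> space (PV t)"
    and P: "prob_space P" "sets P = sets X" and "t \<le> n"
    and F: "F \<in> borel_measurable (PiM {..<t} (\<lambda>_. \<mu>))"
  shows "(\<integral>\<^sup>+xs. \<integral>\<^sup>+ys. F ys \<partial>messages_law \<mu> G t u vs xs \<partial>PiM {..<t} (\<lambda>_. P)) =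
    (\<integral>\<^sup>+ys. ennreal (path_density (\<lambda>t ys. mean_density P (G t u (vs t) ys)) t ys) * F ys \<partial>PiM {..<t} (\<lambda>_. \<mu>))"
  using \<open>t \<le> n\<close> F
proof (induction t arbitrary: F)
  case 0
  then show ?case
    by (simp add: PiM_empty nn_integral_return nn_integral_count_space_finite)
next
  case (Suc t)
  have t: "t < n" using Suc.prems by simp
  let ?g = "\<lambda>t ys. mean_density P (G t u (vs t) ys)"
  let ?M = "\<lambda>t. PiM {..<t} (\<lambda>_. \<mu>)"
  interpret P: prob_space P by fact
  interpret g: conditional_densities \<mu> n ?g
    using conditional_densities_mean_density[OF u vs P] .
  have sig_P: "sigma_finite_measure P" by (rule P.sigma_finite_measure_axioms)
  note F = Suc.prems(2)
  have idX [measurable]: "(\<lambda>x. x) \<in> P \<rightarrow>\<^sub>M X" using P(2) by simp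
  have coordX: "(\<lambda>xs. xs s) \<in> PiM {..<m} (\<lambda>_. P) \<rightarrow>\<^sub>M X" if "s < m" for s m
    using measurable_component_singleton[of s "{..<m}" "\<lambda>_. P"] that
    unfolding measurable_cong_sets[OF refl P(2)] by simp
  have vst: "vs t \<in> space (PV t)" using vs t by simp
  let ?K = "\<lambda>x ys. channel_kernel \<mu> (G t u (vs t) ys) x"
  let ?S = "\<lambda>x ys. ?K x ys \<bind> (\<lambda>y. return (?M (Suc t)) (ys(t := y)))"
  have step: "(\<lambda>(x, ys). ?S x ys) \<in> P \<Otimes>\<^sub>M ?M t \<rightarrow>\<^sub>M prob_algebra (?M (Suc t))"
    using measurable_message_step[OF t, of "\<lambda>_. u" "P \<Otimes>\<^sub>M ?M t" "\<lambda>_. vs t" snd fst] u vst P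
    by (simp add: case_prod_unfold)
  have space_P: "space P = space X" using P(2) by (rule sets_eq_imp_space_eq)
  have step1: "(\<lambda>ys. ?S x ys) \<in> ?M t \<rightarrow>\<^sub>M subprob_algebra (?M (Suc t))" if "x \<in> space P" for x
    using measurable_prob_algebraD[OF measurable_compose[OF measurable_Pair1'[OF that] step]] by simp
  have kernel: "?K x ys \<in> space (prob_algebra \<mu>)" if "x \<in> space P" "ys \<in> space (?M t)" for x ys
    using measurable_space[OF measurable_channel_kernel_G[OF t, of "\<lambda>_. u" P "\<lambda>_. vs t" "\<lambda>_. ys" "\<lambda>x. x"]]
      u vst that by simp
  have nn_step: "(\<integral>\<^sup>+zs. F zs \<partial>?S x ys) = (\<integral>\<^sup>+y. ennreal (G t u (vs t) ys x y) * F (ys(t := y)) \<partial>\<mu>)"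
    if x: "x \<in> space P" and ys: "ys \<in> space (?M t)" for x ys
  proof -
    have app: "(\<lambda>y. ys(t := y)) \<in> \<mu> \<rightarrow>\<^sub>M ?M (Suc t)"
      using ys by (intro measurable_append_message) auto
    have sets_K: "sets (?K x ys) = sets \<mu>"
      by (simp add: channel_kernel_def)
    have ret: "(\<lambda>y. return (?M (Suc t)) (ys(t := y))) \<in> ?K x ys \<rightarrow>\<^sub>M subprob_algebra (?M (Suc t))"
      using measurable_compose[OF app return_measurable] sets_K by (simp cong: measurable_cong_sets)
    interpret input_channel P \<mu> "G t u (vs t) ys"
      using input_channel_G[OF t u vst ys P] .
    have [measurable]: "(\<lambda>y. F (ys(t := y))) \<in> borel_measurable \<mu>"
      by (rule measurable_compose[OF app F])
    have "(\<integral>\<^sup>+zs. F zs \<partial>?S x ys) = (\<integral>\<^sup>+y. \<integral>\<^sup>+zs. F zs \<partial>return (?M (Suc t)) (ys(t := y)) \<partial>?K x ys)"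
      by (rule nn_integral_bind[OF F ret])
    also have "\<dots> = (\<integral>\<^sup>+y. F (ys(t := y)) \<partial>?K x ys)"
      using measurable_space[OF app] F
      by (intro nn_integral_cong nn_integral_return) (auto simp: channel_kernel_def)
    also have "\<dots> = (\<integral>\<^sup>+y. ennreal (G t u (vs t) ys x y) * F (ys(t := y)) \<partial>\<mu>)"
      unfolding channel_kernel_def using x by (intro nn_integral_density) measurable
    finally show ?thesis .
  qed
  have messages: "(\<lambda>xs. messages_law \<mu> G t u vs xs) \<in> PiM {..<t} (\<lambda>_. P) \<rightarrow>\<^sub>M prob_algebra (?M t)"
    using t u vs by (intro measurable_messages_law[of t "\<lambda>_. u" _ "\<lambda>_. vs"]) (auto intro!: coordX)
  have messages': "messages_law \<mu> G t u vs xs \<in> space (prob_algebra (?M t))"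
    if "xs \<in> space (PiM {..<t} (\<lambda>_. P))" for xs
    using measurable_space[OF messages that] .
  have F_step [measurable]: "(\<lambda>(x, ys). \<integral>\<^sup>+zs. F zs \<partial>?S x ys) \<in> borel_measurable (P \<Otimes>\<^sub>M ?M t)"
    using measurable_compose[OF measurable_prob_algebraD[OF step] nn_integral_measurable_subprob_algebra[OF F]]
    by (simp add: case_prod_unfold)
  \<comment> \<open>The test function for the induction hypothesis: the expectation of
    \<open>F\<close> given the past messages, with the last input and the last message averaged
    out.\<close>
  define H where "H ys = (\<integral>\<^sup>+x. \<integral>\<^sup>+zs. F zs \<partial>?S x ys \<partial>P)" for ys
  have H_meas: "H \<in> borel_measurable (?M t)"
    unfolding H_def by (rule P.borel_measurable_nn_integral) (use F_step in \<open>simp add: case_prod_unfold measurable_split_conv\<close>)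
  have H_eq: "H ys = (\<integral>\<^sup>+y. ennreal (?g t ys y) * F (ys(t := y)) \<partial>\<mu>)" if ys: "ys \<in> space (?M t)" for ys
  proof -
    have app: "(\<lambda>y. ys(t := y)) \<in> \<mu> \<rightarrow>\<^sub>M ?M (Suc t)"
      using ys by (intro measurable_append_message) auto
    interpret input_channel P \<mu> "G t u (vs t) ys"
      using input_channel_G[OF t u vst ys P] .
    have [measurable]: "(\<lambda>y. F (ys(t := y))) \<in> borel_measurable \<mu>"
      by (rule measurable_compose[OF app F])
    have "H ys = (\<integral>\<^sup>+x. \<integral>\<^sup>+y. ennreal (G t u (vs t) ys x y) * F (ys(t := y)) \<partial>\<mu> \<partial>P)"
      unfolding H_def by (intro nn_integral_cong) (rule nn_step[OF _ ys])
    \<comment> \<open>Exchanging the integrals isolates the mean of the channel over the input,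
      because \<open>F\<close> sees the input only through the message.\<close>
    also have "\<dots> = (\<integral>\<^sup>+y. \<integral>\<^sup>+x. ennreal (G t u (vs t) ys x y) * F (ys(t := y)) \<partial>P \<partial>\<mu>)"
      by (rule pair.Fubini'[symmetric]) measurable
    also have "\<dots> = (\<integral>\<^sup>+y. (\<integral>\<^sup>+x. ennreal (G t u (vs t) ys x y) \<partial>P) * F (ys(t := y)) \<partial>\<mu>)"
      by (intro nn_integral_cong nn_integral_multc) measurable
    also have "\<dots> = (\<integral>\<^sup>+y. ennreal (?g t ys y) * F (ys(t := y)) \<partial>\<mu>)"
      using AE_mean_density by (intro nn_integral_cong_AE) auto
    finally show ?thesis .
  qed
  have "(\<integral>\<^sup>+xs. \<integral>\<^sup>+ys. F ys \<partial>messages_law \<mu> G (Suc t) u vs xs \<partial>PiM {..<Suc t} (\<lambda>_. P)) =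
      (\<integral>\<^sup>+xs. \<integral>\<^sup>+x. \<integral>\<^sup>+ys. F ys \<partial>messages_law \<mu> G (Suc t) u vs (xs(t := x)) \<partial>P \<partial>PiM {..<t} (\<lambda>_. P))"
  proof (rule nn_integral_PiM_Suc[OF sig_P])
    have "(\<lambda>xs. messages_law \<mu> G (Suc t) u vs xs) \<in> PiM {..<Suc t} (\<lambda>_. P) \<rightarrow>\<^sub>M prob_algebra (?M (Suc t))"
      using Suc.prems(1) u vs
      by (intro measurable_messages_law[of _ "\<lambda>_. u" _ "\<lambda>_. vs"]) (auto intro!: coordX)
    from measurable_compose[OF measurable_prob_algebraD[OF this] nn_integral_measurable_subprob_algebra[OF F]]
    show "(\<lambda>xs. \<integral>\<^sup>+ys. F ys \<partial>messages_law \<mu> G (Suc t) u vs xs) \<in> borel_measurable (PiM {..<Suc t} (\<lambda>_. P))" .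
  qed
  also have "\<dots> = (\<integral>\<^sup>+xs. \<integral>\<^sup>+ys. H ys \<partial>messages_law \<mu> G t u vs xs \<partial>PiM {..<t} (\<lambda>_. P))"
  proof (rule nn_integral_cong)
    fix xs assume xs: "xs \<in> space (PiM {..<t} (\<lambda>_. P))"
    let ?L = "messages_law \<mu> G t u vs xs"
    have L: "prob_space ?L" and sets_L [measurable_cong]: "sets ?L = sets (?M t)"
      using messages'[OF xs] by (auto simp: space_prob_algebra)
    interpret L: prob_space ?L by (rule L)
    interpret PL: pair_sigma_finite P ?L by unfold_locales
    have "(\<integral>\<^sup>+x. \<integral>\<^sup>+ys. F ys \<partial>messages_law \<mu> G (Suc t) u vs (xs(t := x)) \<partial>P)
        = (\<integral>\<^sup>+x. \<integral>\<^sup>+ys. \<integral>\<^sup>+zs. F zs \<partial>?S x ys \<partial>?L \<partial>P)"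
    proof (rule nn_integral_cong)
      fix x assume x: "x \<in> space P"
      have "messages_law \<mu> G t u vs (xs(t := x)) = ?L"
        by (rule messages_law_cong) auto
      then show "(\<integral>\<^sup>+ys. F ys \<partial>messages_law \<mu> G (Suc t) u vs (xs(t := x)))
          = (\<integral>\<^sup>+ys. \<integral>\<^sup>+zs. F zs \<partial>?S x ys \<partial>?L)"
        using step1[OF x] sets_L by (simp add: nn_integral_bind[OF F] cong: measurable_cong_sets)
    qed
    also have "\<dots> = (\<integral>\<^sup>+ys. H ys \<partial>?L)"
      unfolding H_def by (rule PL.Fubini'[symmetric]) (use F_step in \<open>simp cong: measurable_cong_sets\<close>)
    finally show "(\<integral>\<^sup>+x. \<integral>\<^sup>+ys. F ys \<partial>messages_law \<mu> G (Suc t) u vs (xs(t := x)) \<partial>P) = (\<integral>\<^sup>+ys. H ys \<partial>?L)" .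
  qed
  also have "\<dots> = (\<integral>\<^sup>+ys. ennreal (path_density ?g t ys) * H ys \<partial>?M t)"
    using Suc.IH[OF _ H_meas] t by simp
  also have "\<dots> = (\<integral>\<^sup>+ys. ennreal (path_density ?g t ys) *
      (\<integral>\<^sup>+y. ennreal (?g t ys y) * F (ys(t := y)) \<partial>\<mu>) \<partial>?M t)"
    by (intro nn_integral_cong) (simp add: H_eq)
  also have "\<dots> = (\<integral>\<^sup>+ys. ennreal (path_density ?g (Suc t) ys) * F ys \<partial>?M (Suc t))"
    by (rule g.nn_integral_path_density_Suc[OF t F, symmetric])
  finally show ?case .
qed

end

section \<open>The law of the output\<close>

context protocol_setup
begin

text \<open>Here \<open>w\<close> collects the public and all private randomness, while the inputs
  are already averaged out. Fixing the private randomness too turns each round into a single channel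
  once the past is given.\<close>

definition path_law :: "'x measure \<Rightarrow> 'u \<times> (nat \<Rightarrow> 'v) \<Rightarrow> (nat \<Rightarrow> 'y) measure" where
  "path_law P w = density (PiM {..<n} (\<lambda>_. \<mu>))
     (\<lambda>ys. ennreal (path_density (\<lambda>t ys. mean_density P (G t (fst w) (snd w t) ys)) n ys))"

definition seeds :: "('u \<times> (nat \<Rightarrow> 'v)) measure" where
  "seeds = PU \<Otimes>\<^sub>M PiM {..<n} PV"

lemma prob_space_seeds: "prob_space seeds"
proof -
  interpret PU: prob_space PU by (rule PU)
  interpret PVs: prob_space "PiM {..<n} PV" by (intro prob_space_PiM) (simp add: PV)
  interpret pair_prob_space PU "PiM {..<n} PV" by unfold_locales
  show ?thesis unfolding seeds_def by unfold_locales
qed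

lemma seedsD:
  assumes "w \<in> space seeds"
  shows "fst w \<in> space PU" "\<And>t. t < n \<Longrightarrow> snd w t \<in> space (PV t)"
  using assms by (simp_all add: seeds_def space_pair_measure mem_Times_iff space_PiM PiE_iff)

text \<open>The nested binds of \<open>transcript_law\<close> are evaluated on the rectangle
  \<open>A \<times> space PU\<close>, the preimage of \<open>A\<close> under \<open>fst\<close>. The
  innermost average over the inputs is \<open>nn_integral_messages_law\<close> for the indicator of
  \<open>A\<close>, which identifies the kernel with \<open>path_law\<close>; measurability of
  \<open>path_law\<close> in the seeds is inherited from that kernel.\<close>

lemma
  assumes P: "prob_space P" "sets P = sets X"
  shows output_law_prob_algebra: "output_law \<mu> n PU PV G P \<in> space (prob_algebra (PiM {..<n} (\<lambda>_. \<mu>)))"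
    and path_law_measurable: "A \<in> sets (PiM {..<n} (\<lambda>_. \<mu>)) \<Longrightarrow>
      (\<lambda>w. emeasure (path_law P w) A) \<in> borel_measurable seeds"
    and emeasure_output_law: "A \<in> sets (PiM {..<n} (\<lambda>_. \<mu>)) \<Longrightarrow>
      emeasure (output_law \<mu> n PU PV G P) A = (\<integral>\<^sup>+w. emeasure (path_law P w) A \<partial>seeds)"
proof -
  let ?M = "PiM {..<n} (\<lambda>_. \<mu>)" and ?V = "PiM {..<n} PV" and ?X = "PiM {..<n} (\<lambda>_. P)"
  interpret PU: prob_space PU by (rule PU)
  interpret PVs: prob_space ?V by (intro prob_space_PiM) (simp add: PV)
  interpret P: prob_space P by fact
  interpret Xs: prob_space ?X by (intro prob_space_PiM) unfold_locales
  have coordX: "(\<lambda>xs. xs s) \<in> ?X \<rightarrow>\<^sub>M X" if "s < n" for s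
    using measurable_component_singleton[of s "{..<n}" "\<lambda>_. P"] that
    unfolding measurable_cong_sets[OF refl P(2)] by simp
  have coordV: "(\<lambda>vs. vs s) \<in> ?V \<rightarrow>\<^sub>M PV s" if "s < n" for s
    using that by simp
  let ?L = "\<lambda>u vs xs. messages_law \<mu> G n u vs xs"
  let ?K = "\<lambda>u vs xs. ?L u vs xs \<bind> (\<lambda>ys. return (?M \<Otimes>\<^sub>M PU) (ys, u))"
  have L: "(\<lambda>z. ?L (fst (fst z)) (snd (fst z)) (snd z)) \<in> (PU \<Otimes>\<^sub>M ?V) \<Otimes>\<^sub>M ?X \<rightarrow>\<^sub>M prob_algebra ?M"
    by (intro measurable_messages_law order.refl
        measurable_compose[OF measurable_fst measurable_fst]
        measurable_compose[OF measurable_compose[OF measurable_fst measurable_snd] coordV]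
        measurable_compose[OF measurable_snd coordX])
  have K1: "(\<lambda>z. ?K (fst (fst z)) (snd (fst z)) (snd z)) \<in> (PU \<Otimes>\<^sub>M ?V) \<Otimes>\<^sub>M ?X \<rightarrow>\<^sub>M prob_algebra (?M \<Otimes>\<^sub>M PU)"
  proof (rule measurable_bind_prob_space2[OF L])
    have "(\<lambda>zy. (snd zy, fst (fst (fst zy)))) \<in> ((PU \<Otimes>\<^sub>M ?V) \<Otimes>\<^sub>M ?X) \<Otimes>\<^sub>M ?M \<rightarrow>\<^sub>M ?M \<Otimes>\<^sub>M PU"
      by (intro measurable_Pair measurable_snd
          measurable_compose[OF measurable_fst measurable_compose[OF measurable_fst measurable_fst]])
    from measurable_compose[OF this measurable_return_prob_space]
    show "(\<lambda>(z, ys). return (?M \<Otimes>\<^sub>M PU) (ys, fst (fst z)))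
        \<in> ((PU \<Otimes>\<^sub>M ?V) \<Otimes>\<^sub>M ?X) \<Otimes>\<^sub>M ?M \<rightarrow>\<^sub>M prob_algebra (?M \<Otimes>\<^sub>M PU)"
      by (simp add: case_prod_unfold)
  qed
  have K2: "(\<lambda>w. ?X \<bind> ?K (fst w) (snd w)) \<in> PU \<Otimes>\<^sub>M ?V \<rightarrow>\<^sub>M prob_algebra (?M \<Otimes>\<^sub>M PU)"
    by (rule measurable_bind_prob_space2[OF measurable_const[OF Xs.prob_algebra_self]])
       (use K1 in \<open>simp add: case_prod_unfold\<close>)
  have K3: "(\<lambda>u. ?V \<bind> (\<lambda>vs. ?X \<bind> ?K u vs)) \<in> PU \<rightarrow>\<^sub>M prob_algebra (?M \<Otimes>\<^sub>M PU)"
    by (rule measurable_bind_prob_space2[OF measurable_const[OF PVs.prob_algebra_self]])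
       (use K2 in \<open>simp add: case_prod_unfold\<close>)
  let ?T = "transcript_law \<mu> n PU PV G P"
  have T: "?T \<in> space (prob_algebra (?M \<Otimes>\<^sub>M PU))"
    unfolding transcript_law_def space_prob_algebra
    using prob_space_bind'[OF PU.prob_algebra_self K3] sets_bind'[OF PU.prob_algebra_self K3] by simp
  then have T': "prob_space ?T" "sets ?T = sets (?M \<Otimes>\<^sub>M PU)"
    by (auto simp: space_prob_algebra)
  have fst_T: "fst \<in> ?T \<rightarrow>\<^sub>M ?M"
    unfolding measurable_cong_sets[OF T'(2) refl] by simp
  show "output_law \<mu> n PU PV G P \<in> space (prob_algebra ?M)"
    unfolding output_law_def space_prob_algebra
    using prob_space.prob_space_distr[OF T'(1) fst_T] by simp
  assume A: "A \<in> sets ?M"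
  have K2w: "(\<lambda>vs. ?X \<bind> ?K u vs) \<in> ?V \<rightarrow>\<^sub>M prob_algebra (?M \<Otimes>\<^sub>M PU)" if "u \<in> space PU" for u
    using measurable_compose[OF measurable_Pair1'[OF that] K2] by simp
  have K1w: "(\<lambda>xs. ?K u vs xs) \<in> ?X \<rightarrow>\<^sub>M prob_algebra (?M \<Otimes>\<^sub>M PU)"
      and Lw: "(\<lambda>xs. ?L u vs xs) \<in> ?X \<rightarrow>\<^sub>M prob_algebra ?M"
    if "u \<in> space PU" "vs \<in> space ?V" for u vs
  proof -
    have "(u, vs) \<in> space (PU \<Otimes>\<^sub>M ?V)" using that by (simp add: space_pair_measure)
    note p = measurable_Pair1'[OF this]
    show "(\<lambda>xs. ?K u vs xs) \<in> ?X \<rightarrow>\<^sub>M prob_algebra (?M \<Otimes>\<^sub>M PU)" "(\<lambda>xs. ?L u vs xs) \<in> ?X \<rightarrow>\<^sub>M prob_algebra ?M"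
      using measurable_compose[OF p K1] measurable_compose[OF p L] by simp_all
  qed
  have set: "A \<times> space PU \<in> sets (?M \<Otimes>\<^sub>M PU)"
    using A by simp
  have inner: "(\<integral>\<^sup>+xs. emeasure (?L u vs xs) A \<partial>?X) = emeasure (path_law P (u, vs)) A"
    if u: "u \<in> space PU" and vs: "vs \<in> space ?V" for u vs
  proof -
    have vs': "vs t \<in> space (PV t)" if "t < n" for t
      using vs that by (simp add: space_PiM PiE_iff)
    interpret g: conditional_densities \<mu> n "\<lambda>t ys. mean_density P (G t u (vs t) ys)"
      using conditional_densities_mean_density[OF u vs' P] .
    have "(\<integral>\<^sup>+xs. emeasure (?L u vs xs) A \<partial>?X) = (\<integral>\<^sup>+xs. \<integral>\<^sup>+ys. indicator A ys \<partial>?L u vs xs \<partial>?X)"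
      using measurable_space[OF Lw[OF u vs]] A
      by (intro nn_integral_cong) (auto simp: space_prob_algebra)
    also have "\<dots> = emeasure (path_law P (u, vs)) A"
      using A by (subst nn_integral_messages_law[OF u vs' P order.refl])
        (auto simp: path_law_def emeasure_density)
    finally show ?thesis .
  qed
  have inner2: "emeasure (?K u vs xs) (A \<times> space PU) = emeasure (?L u vs xs) A"
    if u: "u \<in> space PU" and vs: "vs \<in> space ?V" and xs: "xs \<in> space ?X" for u vs xs
  proof -
    have Lm: "?L u vs xs \<in> space (prob_algebra ?M)"
      using measurable_space[OF Lw[OF u vs] xs] .
    have "(\<lambda>ys. (ys, u)) \<in> ?M \<rightarrow>\<^sub>M ?M \<Otimes>\<^sub>M PU"
      using u by (intro measurable_Pair measurable_const) auto
    note r = measurable_compose[OF this measurable_return_prob_space]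
    have "emeasure (?K u vs xs) (A \<times> space PU)
        = (\<integral>\<^sup>+ys. emeasure (return (?M \<Otimes>\<^sub>M PU) (ys, u)) (A \<times> space PU) \<partial>?L u vs xs)"
      by (rule emeasure_bind_prob_algebra[OF Lm r set])
    also have "\<dots> = (\<integral>\<^sup>+ys. indicator A ys \<partial>?L u vs xs)"
      using u set by (intro nn_integral_cong) (auto split: split_indicator)
    also have "\<dots> = emeasure (?L u vs xs) A"
      using Lm A by (simp add: space_prob_algebra)
    finally show ?thesis .
  qed
  have kern: "emeasure (?X \<bind> ?K u vs) (A \<times> space PU) = emeasure (path_law P (u, vs)) A"
    if u: "u \<in> space PU" and vs: "vs \<in> space ?V" for u vs
  proof -
    have "emeasure (?X \<bind> ?K u vs) (A \<times> space PU) = (\<integral>\<^sup>+xs. emeasure (?K u vs xs) (A \<times> space PU) \<partial>?X)"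
      by (rule emeasure_bind_prob_algebra[OF Xs.prob_algebra_self K1w[OF u vs] set])
    also have "\<dots> = (\<integral>\<^sup>+xs. emeasure (?L u vs xs) A \<partial>?X)"
      by (intro nn_integral_cong inner2[OF u vs])
    finally show ?thesis using inner[OF u vs] by simp
  qed
  have "(\<lambda>w. emeasure (?X \<bind> ?K (fst w) (snd w)) (A \<times> space PU)) \<in> borel_measurable (PU \<Otimes>\<^sub>M ?V)"
    using measurable_compose[OF measurable_prob_algebraD[OF K2] measurable_emeasure_subprob_algebra[OF set]] .
  also have "?this \<longleftrightarrow> (\<lambda>w. emeasure (path_law P w) A) \<in> borel_measurable (PU \<Otimes>\<^sub>M ?V)"
    by (intro measurable_cong) (auto simp: space_pair_measure kern)
  finally show meas: "(\<lambda>w. emeasure (path_law P w) A) \<in> borel_measurable seeds"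
    unfolding seeds_def .
  have "emeasure (output_law \<mu> n PU PV G P) A = emeasure ?T (A \<times> space PU)"
  proof -
    have "fst -` A \<inter> space ?T = A \<times> space PU"
      using sets.sets_into_space[OF A] sets_eq_imp_space_eq[OF T'(2)] by (auto simp: space_pair_measure)
    then show ?thesis
      unfolding output_law_def by (simp add: emeasure_distr[OF fst_T A])
  qed
  also have "\<dots> = (\<integral>\<^sup>+u. emeasure (?V \<bind> (\<lambda>vs. ?X \<bind> ?K u vs)) (A \<times> space PU) \<partial>PU)"
    unfolding transcript_law_def by (rule emeasure_bind_prob_algebra[OF PU.prob_algebra_self K3 set])
  also have "\<dots> = (\<integral>\<^sup>+u. \<integral>\<^sup>+vs. emeasure (?X \<bind> ?K u vs) (A \<times> space PU) \<partial>?V \<partial>PU)"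
    by (intro nn_integral_cong emeasure_bind_prob_algebra[OF PVs.prob_algebra_self K2w set])
  also have "\<dots> = (\<integral>\<^sup>+u. \<integral>\<^sup>+vs. emeasure (path_law P (u, vs)) A \<partial>?V \<partial>PU)"
    by (intro nn_integral_cong) (simp add: kern)
  also have "\<dots> = (\<integral>\<^sup>+w. emeasure (path_law P w) A \<partial>seeds)"
    unfolding seeds_def using meas[unfolded seeds_def]
    by (subst PVs.nn_integral_fst[symmetric]) auto
  finally show "emeasure (output_law \<mu> n PU PV G P) A = (\<integral>\<^sup>+w. emeasure (path_law P w) A \<partial>seeds)" .
qed

lemma prob_space_path_law:
  assumes "w \<in> space seeds" "prob_space P" "sets P = sets X"
  shows "prob_space (path_law P w)"
proof -
  interpret g: conditional_densities \<mu> n "\<lambda>t ys. mean_density P (G t (fst w) (snd w t) ys)"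
    using conditional_densities_mean_density[OF seedsD[OF assms(1)] assms(2,3)] .
  show ?thesis
    unfolding path_law_def
    by (intro prob_spaceI) (simp add: emeasure_density g.path_density_mass cong: nn_integral_cong)
qed

lemma
  assumes P: "prob_space P" "sets P = sets X" and A: "A \<in> sets (PiM {..<n} (\<lambda>_. \<mu>))"
  shows integrable_path_law: "integrable seeds (\<lambda>w. measure (path_law P w) A)"
    and measure_output_law: "measure (output_law \<mu> n PU PV G P) A = (\<integral>w. measure (path_law P w) A \<partial>seeds)"
proof -
  interpret S: prob_space seeds by (rule prob_space_seeds)
  note [measurable] = path_law_measurable[OF P A]
  have le: "measure (path_law P w) A \<le> 1" and eq: "emeasure (path_law P w) A = ennreal (measure (path_law P w) A)"
    if "w \<in> space seeds" for w
  proof -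
    interpret prob_space "path_law P w" by (rule prob_space_path_law[OF that P])
    show "measure (path_law P w) A \<le> 1" "emeasure (path_law P w) A = ennreal (measure (path_law P w) A)"
      by (auto simp: emeasure_eq_measure)
  qed
  have [measurable]: "(\<lambda>w. measure (path_law P w) A) \<in> borel_measurable seeds"
    unfolding measure_def by measurable
  show int: "integrable seeds (\<lambda>w. measure (path_law P w) A)"
    by (rule S.integrable_const_bound[where B = 1]) (auto intro!: AE_I2 le)
  have "emeasure (output_law \<mu> n PU PV G P) A = (\<integral>\<^sup>+w. ennreal (measure (path_law P w) A) \<partial>seeds)"
    unfolding emeasure_output_law[OF P A] by (intro nn_integral_cong eq)
  also have "\<dots> = ennreal (\<integral>w. measure (path_law P w) A \<partial>seeds)"
    using int by (intro nn_integral_eq_integral) auto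
  finally show "measure (output_law \<mu> n PU PV G P) A = (\<integral>w. measure (path_law P w) A \<partial>seeds)"
    by (simp add: measure_def)
qed

lemma path_law_TV_bound:
  assumes w: "w \<in> space seeds" and A: "A \<in> sets (PiM {..<n} (\<lambda>_. \<mu>))"
    and P: "prob_space P" "sets P = sets X" and Q: "prob_space Q" "sets Q = sets X"
  shows "ennreal ((measure (path_law P w) A - measure (path_law Q w) A)\<^sup>2) \<le>
    2 * (\<Sum>t<n. \<integral>\<^sup>+ys. ennreal (path_density (\<lambda>t ys. mean_density P (G t (fst w) (snd w t) ys)) t ys) *
      chi_square \<mu> (mean_density P (G t (fst w) (snd w t) ys)) (mean_density Q (G t (fst w) (snd w t) ys))
      \<partial>PiM {..<t} (\<lambda>_. \<mu>))"
  using path_density_TV_bound[OF conditional_densities_mean_density[OF seedsD[OF w] P]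
      conditional_densities_mean_density[OF seedsD[OF w] Q] A]
  by (simp add: path_law_def)

text \<open>The density of the past belongs to \<open>P\<close> and is the same for every
  \<open>i\<close>, so the sum over \<open>i\<close> can be taken under the integral. At a given
  past all \<open>k\<close> terms then involve one channel of the round, the bound
  \<open>C t\<close> applies, and the density of the past integrates to one. The test set may depend
  on \<open>i\<close>.\<close>

lemma path_law_sum_TV_bound:
  fixes k :: nat
  assumes w: "w \<in> space seeds" and A: "\<And>i. i < k \<Longrightarrow> A i \<in> sets (PiM {..<n} (\<lambda>_. \<mu>))"
    and P: "prob_space P" "sets P = sets X"
    and Q: "\<And>i. i < k \<Longrightarrow> prob_space (Q i)" "\<And>i. i < k \<Longrightarrow> sets (Q i) = sets X"
    and C: "\<And>t V. t < n \<Longrightarrow> V \<in> \<W> t \<Longrightarrow>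
      (\<Sum>i<k. chi_square \<mu> (mean_density P V) (mean_density (Q i) V)) \<le> C t"
  shows "(\<Sum>i<k. ennreal ((measure (path_law P w) (A i) - measure (path_law (Q i) w) (A i))\<^sup>2))
    \<le> 2 * (\<Sum>t<n. C t)"
proof -
  let ?V = "\<lambda>t. G t (fst w) (snd w t)"
  let ?\<rho> = "path_density (\<lambda>t ys. mean_density P (?V t ys))"
  let ?M = "\<lambda>t. PiM {..<t} (\<lambda>_. \<mu>)"
  interpret p: conditional_densities \<mu> n "\<lambda>t ys. mean_density P (?V t ys)"
    using conditional_densities_mean_density[OF seedsD[OF w] P] .
  have "(\<Sum>i<k. ennreal ((measure (path_law P w) (A i) - measure (path_law (Q i) w) (A i))\<^sup>2))
    \<le> (\<Sum>i<k. 2 * (\<Sum>t<n. \<integral>\<^sup>+ys. ennreal (?\<rho> t ys) *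
      chi_square \<mu> (mean_density P (?V t ys)) (mean_density (Q i) (?V t ys)) \<partial>?M t))"
    using w A P Q by (intro sum_mono path_law_TV_bound) auto
  also have "\<dots> = 2 * (\<Sum>t<n. \<Sum>i<k. \<integral>\<^sup>+ys. ennreal (?\<rho> t ys) *
      chi_square \<mu> (mean_density P (?V t ys)) (mean_density (Q i) (?V t ys)) \<partial>?M t)"
    by (subst sum.swap) (simp add: sum_distrib_left)
  also have "\<dots> \<le> 2 * (\<Sum>t<n. C t)"
  proof (intro mult_left_mono sum_mono)
    fix t assume "t \<in> {..<n}"
    then have t: "t < n" "t \<le> n" by auto
    have [measurable]: "?\<rho> t \<in> borel_measurable (?M t)"
      using t by simp
    have [measurable]: "(\<lambda>ys. chi_square \<mu> (mean_density P (?V t ys)) (mean_density (Q i) (?V t ys))) \<in> borel_measurable (?M t)"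
      if "i < k" for i
    proof -
      interpret q: conditional_densities \<mu> n "\<lambda>t ys. mean_density (Q i) (?V t ys)"
        using conditional_densities_mean_density[OF seedsD[OF w]] Q that by blast
      note [measurable] = p.meas[OF t(1)] q.meas[OF t(1)]
      show ?thesis unfolding chi_square_def by measurable
    qed
    have "(\<Sum>i<k. \<integral>\<^sup>+ys. ennreal (?\<rho> t ys) *
        chi_square \<mu> (mean_density P (?V t ys)) (mean_density (Q i) (?V t ys)) \<partial>?M t)
      = (\<integral>\<^sup>+ys. (\<Sum>i<k. ennreal (?\<rho> t ys) *
        chi_square \<mu> (mean_density P (?V t ys)) (mean_density (Q i) (?V t ys))) \<partial>?M t)"
      by (rule nn_integral_sum[symmetric]) simp
    also have "\<dots> \<le> (\<integral>\<^sup>+ys. ennreal (?\<rho> t ys) * C t \<partial>?M t)"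
    proof (rule nn_integral_mono)
      fix ys assume ys: "ys \<in> space (?M t)"
      show "(\<Sum>i<k. ennreal (?\<rho> t ys) *
          chi_square \<mu> (mean_density P (?V t ys)) (mean_density (Q i) (?V t ys))) \<le> ennreal (?\<rho> t ys) * C t"
        unfolding sum_distrib_left[symmetric]
        using G_channel(1)[OF t(1) seedsD(1)[OF w] seedsD(2)[OF w t(1)] ys]
        by (intro mult_left_mono C t) auto
    qed
    also have "\<dots> = (\<integral>\<^sup>+ys. ennreal (?\<rho> t ys) \<partial>?M t) * C t"
      by (rule nn_integral_multc) simp
    finally show "(\<Sum>i<k. \<integral>\<^sup>+ys. ennreal (?\<rho> t ys) *
        chi_square \<mu> (mean_density P (?V t ys)) (mean_density (Q i) (?V t ys)) \<partial>?M t) \<le> C t"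
      using p.path_density_mass[OF t(2)] by simp
  qed auto
  finally show ?thesis .
qed

end

section \<open>Mixtures over the sign cube\<close>

lemma finite_sign_cube: "finite (sign_cube k)"
  by (auto simp: sign_cube_def intro!: finite_PiE)

lemma sign_cube_values: "z \<in> sign_cube k \<Longrightarrow> i < k \<Longrightarrow> z i = 1 \<or> z i = -1"
  by (auto simp: sign_cube_def dest!: PiE_mem)

lemma flip_sign_cube: "z \<in> sign_cube k \<Longrightarrow> i < k \<Longrightarrow> flip z i \<in> sign_cube k"
  by (auto simp: sign_cube_def flip_def PiE_iff extensional_def)

lemma flip_flip [simp]: "flip (flip z i) i = z"
  by (simp add: flip_def)

lemma pmf_rad:
  assumes "0 < \<tau>" "\<tau> \<le> 1/2"
  shows "pmf (rad_pmf \<tau>) 1 = \<tau>" "pmf (rad_pmf \<tau>) (-1) = 1 - \<tau>" "set_pmf (rad_pmf \<tau>) = {-1, 1}"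
proof -
  have inj: "inj (\<lambda>b. if b then 1 else -1 :: int)"
    by (rule injI) (auto split: if_splits)
  show "pmf (rad_pmf \<tau>) 1 = \<tau>" "pmf (rad_pmf \<tau>) (-1) = 1 - \<tau>"
    using pmf_map_inj'[OF inj, of "bernoulli_pmf \<tau>" True] pmf_map_inj'[OF inj, of "bernoulli_pmf \<tau>" False] assms
    by (auto simp: rad_pmf_def)
  show "set_pmf (rad_pmf \<tau>) = {-1, 1}"
    using assms by (auto simp: rad_pmf_def set_pmf_bernoulli)
qed

lemma set_rad_cube:
  assumes "0 < \<tau>" "\<tau> \<le> 1/2"
  shows "set_pmf (rad_cube \<tau> k) = sign_cube k"
  unfolding rad_cube_def using pmf_rad(3)[OF assms]
  by (simp add: set_Pi_pmf) (auto simp: PiE_dflt_def sign_cube_def PiE_iff extensional_def)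

lemma pmf_rad_cube:
  assumes "z \<in> sign_cube k"
  shows "pmf (rad_cube \<tau> k) z = (\<Prod>j<k. pmf (rad_pmf \<tau>) (z j))"
  unfolding rad_cube_def using assms
  by (intro pmf_Pi') (auto simp: sign_cube_def PiE_iff extensional_def)

lemma prob_rad_cube_coordinate:
  assumes "i < k"
  shows "measure_pmf.prob (rad_cube \<tau> k) {z. z i = s} = pmf (rad_pmf \<tau>) s"
proof -
  have "measure_pmf.prob (rad_cube \<tau> k) {z. z i = s} = pmf (map_pmf (\<lambda>z. z i) (rad_cube \<tau> k)) s"
    by (simp add: pmf_map vimage_def)
  also have "map_pmf (\<lambda>z. z i) (rad_cube \<tau> k) = rad_pmf \<tau>"
    using assms by (simp add: rad_cube_def Pi_pmf_component)
  finally show ?thesis .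
qed

text \<open>Conditioning a product law on its i-th coordinate cancels the i-th factor, so the
  remaining weights do not mention \<open>s\<close>. On the support, a finite set with all subsets
  measurable, every family \<open>L\<close> is a kernel.\<close>

lemma
  assumes \<tau>: "0 < \<tau>" "\<tau> \<le> 1/2" and i: "i < k" and s: "s = 1 \<or> s = -1"
    and L: "\<And>z. z \<in> sign_cube k \<Longrightarrow> L z \<in> space (prob_algebra N)"
  shows conditional_mixture_prob_algebra: "conditional_mixture \<tau> k i s L \<in> space (prob_algebra N)"
    and conditional_mixture_measure: "A \<in> sets N \<Longrightarrow> measure (conditional_mixture \<tau> k i s L) A =
      (\<Sum>z\<in>{z\<in>sign_cube k. z i = s}. (\<Prod>j\<in>{..<k} - {i}. pmf (rad_pmf \<tau>) (z j)) * measure (L z) A)"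
proof -
  let ?S = "{z\<in>sign_cube k. z i = s}"
  let ?D = "cond_pmf (rad_cube \<tau> k) {z. z i = s}"
  let ?R = "restrict_space (measure_pmf ?D) ?S"
  have pos: "pmf (rad_pmf \<tau>) s > 0"
    using s pmf_rad[OF \<tau>] \<tau> by auto
  \<comment> \<open>A point of the support with i-th coordinate \<open>s\<close>, so that the
    conditioning event has positive probability.\<close>
  define z0 where "z0 = (\<lambda>j. if j < k then s else undefined)"
  have z0: "z0 \<in> ?S"
    using s i by (auto simp: z0_def sign_cube_def PiE_iff extensional_def)
  have ne: "set_pmf (rad_cube \<tau> k) \<inter> {z. z i = s} \<noteq> {}"
    using z0 set_rad_cube[OF \<tau>, of k] by auto
  have set_D: "set_pmf ?D = ?S"
    using set_rad_cube[OF \<tau>, of k] ne by auto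
  have pmf_D: "pmf ?D z = (\<Prod>j\<in>{..<k} - {i}. pmf (rad_pmf \<tau>) (z j))" if "z \<in> ?S" for z
  proof -
    have "pmf ?D z = (\<Prod>j<k. pmf (rad_pmf \<tau>) (z j)) / pmf (rad_pmf \<tau>) s"
      using that by (simp add: pmf_cond[OF ne] prob_rad_cube_coordinate[OF i] pmf_rad_cube)
    also have "(\<Prod>j<k. pmf (rad_pmf \<tau>) (z j)) = pmf (rad_pmf \<tau>) s * (\<Prod>j\<in>{..<k} - {i}. pmf (rad_pmf \<tau>) (z j))"
      using that i by (subst prod.remove[of _ i]) auto
    finally show ?thesis using pos by simp
  qed
  have space_R: "space ?R = ?S"
    by (simp add: space_restrict_space)
  have sets_R: "sets ?R = sets (count_space ?S)"
    by (auto simp: sets_restrict_space)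
  have meas: "L \<in> ?R \<rightarrow>\<^sub>M subprob_algebra N"
    unfolding measurable_cong_sets[OF sets_R refl]
    using L by (auto simp: space_prob_algebra space_subprob_algebra prob_space_imp_subprob_space)
  have mix: "conditional_mixture \<tau> k i s L = ?R \<bind> L"
    by (simp only: conditional_mixture_def Let_def set_D)
  have "emeasure (measure_pmf ?D) ?S = 1"
    using set_D by (simp add: measure_pmf.emeasure_eq_measure measure_pmf.prob_eq_1 AE_measure_pmf_iff)
  then have R: "prob_space ?R"
    by (intro prob_space_restrict_space) auto
  have "L \<in> ?R \<rightarrow>\<^sub>M prob_algebra N"
    using L space_R by (intro measurable_prob_algebraI[OF _ meas]) (auto simp: space_prob_algebra)
  with R show "conditional_mixture \<tau> k i s L \<in> space (prob_algebra N)"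
    unfolding mix space_prob_algebra
    using prob_space_bind'[of ?R ?R L N] sets_bind'[of ?R ?R L N] by (simp add: space_prob_algebra)
  assume A: "A \<in> sets N"
  have fin: "finite ?S" using finite_sign_cube by simp
  have "emeasure (?R \<bind> L) A = (\<integral>\<^sup>+z. emeasure (L z) A \<partial>?R)"
    using z0 space_R by (intro emeasure_bind[OF _ meas A]) auto
  also have "\<dots> = (\<integral>\<^sup>+z. emeasure (L z) A * indicator ?S z \<partial>measure_pmf ?D)"
    by (intro nn_integral_restrict_space) simp
  also have "\<dots> = (\<Sum>z\<in>?S. emeasure (L z) A * indicator ?S z * ennreal (pmf ?D z))"
    using nn_integral_measure_pmf_finite[of ?D] set_D fin by simp
  also have "\<dots> = (\<Sum>z\<in>?S. ennreal (pmf ?D z * measure (L z) A))"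
  proof (intro sum.cong refl)
    fix z assume z: "z \<in> ?S"
    then interpret prob_space "L z" using L by (simp add: space_prob_algebra)
    show "emeasure (L z) A * indicator ?S z * ennreal (pmf ?D z) = ennreal (pmf ?D z * measure (L z) A)"
      using z by (simp add: emeasure_eq_measure ennreal_mult mult.commute)
  qed
  also have "\<dots> = ennreal (\<Sum>z\<in>?S. pmf ?D z * measure (L z) A)"
    by (rule sum_ennreal) simp
  finally have "measure (?R \<bind> L) A = (\<Sum>z\<in>?S. pmf ?D z * measure (L z) A)"
    by (simp add: measure_def sum_nonneg)
  also have "\<dots> = (\<Sum>z\<in>?S. (\<Prod>j\<in>{..<k} - {i}. pmf (rad_pmf \<tau>) (z j)) * measure (L z) A)"
    by (intro sum.cong refl) (simp add: pmf_D)
  finally show "measure (conditional_mixture \<tau> k i s L) A =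
      (\<Sum>z\<in>?S. (\<Prod>j\<in>{..<k} - {i}. pmf (rad_pmf \<tau>) (z j)) * measure (L z) A)"
    unfolding mix .
qed

text \<open>Both conditional laws give the coordinates other than \<open>i\<close> the same weight, so their difference is
  an average over pairs \<open>{z, flip z i}\<close>; it can be read as an average over \<open>z\<close> itself because
  the summand below is invariant under \<open>flip\<close>.\<close>

lemma conditional_mixture_diff:
  assumes \<tau>: "0 < \<tau>" "\<tau> \<le> 1/2" and i: "i < k"
    and L: "\<And>z. z \<in> sign_cube k \<Longrightarrow> L z \<in> space (prob_algebra N)" and A: "A \<in> sets N"
  shows "measure (conditional_mixture \<tau> k i 1 L) A - measure (conditional_mixture \<tau> k i (-1) L) A =
    (\<Sum>z\<in>sign_cube k. pmf (rad_cube \<tau> k) z * (of_int (z i) * (measure (L z) A - measure (L (flip z i)) A)))"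
proof -
  let ?S = "\<lambda>s. {z\<in>sign_cube k. z i = s}"
  define v where "v z = (\<Prod>j\<in>{..<k} - {i}. pmf (rad_pmf \<tau>) (z j))" for z
  define m where "m z = measure (L z) A" for z
  have v_flip: "v (flip z i) = v z" for z
    unfolding v_def by (intro prod.cong) (auto simp: flip_def)
  have pmf: "pmf (rad_cube \<tau> k) z = pmf (rad_pmf \<tau>) (z i) * v z" if "z \<in> sign_cube k" for z
    using that i unfolding pmf_rad_cube[OF that] v_def by (subst prod.remove[of _ i]) auto
  have reindex: "(\<Sum>z\<in>?S (-1). f z) = (\<Sum>z\<in>?S 1. f (flip z i))" for f :: "_ \<Rightarrow> real"
    by (rule sum.reindex_bij_witness[of _ "\<lambda>z. flip z i" "\<lambda>z. flip z i"])
       (use i in \<open>auto simp: flip_sign_cube\<close>, auto simp: flip_def)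
  have split: "(\<Sum>z\<in>sign_cube k. f z) = (\<Sum>z\<in>?S 1. f z + f (flip z i))" for f :: "_ \<Rightarrow> real"
  proof -
    have "sign_cube k = ?S 1 \<union> ?S (-1)"
      using sign_cube_values i by blast
    then have "(\<Sum>z\<in>sign_cube k. f z) = (\<Sum>z\<in>?S 1. f z) + (\<Sum>z\<in>?S (-1). f z)"
      using finite_sign_cube[of k] by (subst sum.union_disjoint[symmetric]) auto
    then show ?thesis by (simp add: reindex sum.distrib)
  qed
  have "measure (conditional_mixture \<tau> k i 1 L) A - measure (conditional_mixture \<tau> k i (-1) L) A
      = (\<Sum>z\<in>?S 1. v z * m z) - (\<Sum>z\<in>?S (-1). v z * m z)"
    using conditional_mixture_measure[OF \<tau> i _ L A] by (simp add: v_def m_def)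
  also have "\<dots> = (\<Sum>z\<in>?S 1. v z * (m z - m (flip z i)))"
    by (simp add: reindex v_flip sum_subtractf right_diff_distrib)
  also have "\<dots> = (\<Sum>z\<in>?S 1. pmf (rad_cube \<tau> k) z * (of_int (z i) * (m z - m (flip z i)))
      + pmf (rad_cube \<tau> k) (flip z i) * (of_int (flip z i i) * (m (flip z i) - m (flip (flip z i) i))))"
  proof (intro sum.cong refl)
    fix z assume "z \<in> ?S 1"
    then have z: "z \<in> sign_cube k" "z i = 1" and f: "flip z i i = -1" by (auto simp: flip_def)
    show "v z * (m z - m (flip z i)) = pmf (rad_cube \<tau> k) z * (of_int (z i) * (m z - m (flip z i)))
      + pmf (rad_cube \<tau> k) (flip z i) * (of_int (flip z i i) * (m (flip z i) - m (flip (flip z i) i)))"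
      using z f
      by (simp add: pmf[OF z(1)] pmf[OF flip_sign_cube[OF z(1) i]] v_flip pmf_rad(1,2)[OF \<tau>] algebra_simps)
  qed
  also have "\<dots> = (\<Sum>z\<in>sign_cube k. pmf (rad_cube \<tau> k) z * (of_int (z i) * (m z - m (flip z i))))"
    by (rule split[symmetric])
  finally show ?thesis by (simp add: m_def)
qed

text \<open>A test set that is optimal up to \<open>e\<close> suffices for the later averaging
  argument and avoids a Hahn decomposition.\<close>

lemma
  assumes M: "M \<in> space (prob_algebra N)" and M': "M' \<in> space (prob_algebra N)"
  shows tv_distance_nonneg: "0 \<le> tv_distance M M'"
    and tv_distance_approx: "e > 0 \<Longrightarrow> \<exists>A\<in>sets N. tv_distance M M' \<le> \<bar>measure M A - measure M' A\<bar> + e"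
proof -
  interpret M: prob_space M using M by (simp add: space_prob_algebra)
  interpret M': prob_space M' using M' by (simp add: space_prob_algebra)
  have sets: "sets M = sets N" using M by (simp add: space_prob_algebra)
  have "\<bar>M.prob A - M'.prob A\<bar> \<le> 1" for A
    using M.prob_le_1[of A] M'.prob_le_1[of A] measure_nonneg[of M A] measure_nonneg[of M' A]
    unfolding abs_le_iff by linarith
  then have bdd: "bdd_above ((\<lambda>A. \<bar>M.prob A - M'.prob A\<bar>) ` sets M)"
    by (intro bdd_aboveI2[where M = 1])
  show "0 \<le> tv_distance M M'"
    using cSUP_upper[OF sets.empty_sets bdd] by (simp add: tv_distance_def)
  assume "e > 0"
  then have "\<exists>A\<in>sets M. tv_distance M M' - e < \<bar>M.prob A - M'.prob A\<bar>"
    unfolding tv_distance_def using sets.empty_sets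
    by (intro less_cSUP_iff[OF _ bdd, THEN iffD1]) auto
  with sets show "\<exists>A\<in>sets N. tv_distance M M' \<le> \<bar>measure M A - measure M' A\<bar> + e"
    by force
qed

context protocol_setup
begin

text \<open>Near-optimal test sets and the signs of the resulting differences make the sum of total
  variations linear: up to \<open>e\<close> it is an average, over \<open>z\<close> and the seeds,
  of sums with coefficients bounded by one. Cauchy-Schwarz for each \<open>z\<close> and each seed
  bounds these sums by a constant, and a constant survives both averages.\<close>

lemma mixture_TV_sum_bound:
  fixes k :: nat and p :: "(nat \<Rightarrow> int) \<Rightarrow> 'x measure"
  assumes k: "1 \<le> k" and \<tau>: "0 < \<tau>" "\<tau> \<le> 1/2"
    and p: "\<And>z. z \<in> sign_cube k \<Longrightarrow> prob_space (p z)" "\<And>z. z \<in> sign_cube k \<Longrightarrow> sets (p z) = sets X"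
    and C: "\<And>z t V. z \<in> sign_cube k \<Longrightarrow> t < n \<Longrightarrow> V \<in> \<W> t \<Longrightarrow>
      (\<Sum>i<k. chi_square \<mu> (mean_density (p z) V) (mean_density (p (flip z i)) V)) \<le> C t"
  shows "ennreal ((1 / real k * (\<Sum>i<k. tv_distance
          (conditional_mixture \<tau> k i 1 (\<lambda>z. output_law \<mu> n PU PV G (p z)))
          (conditional_mixture \<tau> k i (-1) (\<lambda>z. output_law \<mu> n PU PV G (p z)))))\<^sup>2)
    \<le> ennreal (2 / real k) * (\<Sum>t<n. C t)"
proof (cases "(\<Sum>t<n. C t) = \<infinity>")
  case True
  have "ennreal (2 / real k) * (\<Sum>t<n. C t) = \<infinity>"
    unfolding True using k by (simp add: ennreal_mult_eq_top_iff)
  then show ?thesis by (simp only: infinity_ennreal_def top_greatest)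
next
  case False
  then obtain b where b: "0 \<le> b" "(\<Sum>t<n. C t) = ennreal b"
    by (cases "\<Sum>t<n. C t") auto
  let ?N = "PiM {..<n} (\<lambda>_. \<mu>)"
  define L where "L = (\<lambda>z. output_law \<mu> n PU PV G (p z))"
  let ?mix = "\<lambda>i s. conditional_mixture \<tau> k i s L"
  define tv where "tv i = tv_distance (?mix i 1) (?mix i (-1))" for i
  \<comment> \<open>The Cauchy-Schwarz bound for \<open>k\<close> numbers whose squares sum to at
    most \<open>2 * b\<close>.\<close>
  define s where "s = sqrt (real k * (2 * b))"
  have L: "L z \<in> space (prob_algebra ?N)" if "z \<in> sign_cube k" for z
    unfolding L_def using p that by (intro output_law_prob_algebra)
  have mix: "?mix i r \<in> space (prob_algebra ?N)" if "i < k" "r = 1 \<or> r = -1" for i r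
    by (rule conditional_mixture_prob_algebra[OF \<tau> that L])
  have wt: "(\<Sum>z\<in>sign_cube k. pmf (rad_cube \<tau> k) z) = 1"
    using set_rad_cube[OF \<tau>, of k] by (intro sum_pmf_eq_1 finite_sign_cube) auto
  have "(\<Sum>i<k. tv i) \<le> s"
  proof (rule field_le_epsilon)
    fix e :: real assume "e > 0"
    \<comment> \<open>An error of \<open>e / real k\<close> for each coordinate adds up to
      \<open>e\<close>.\<close>
    have "\<exists>A\<in>sets ?N. tv i \<le> \<bar>measure (?mix i 1) A - measure (?mix i (-1)) A\<bar> + e / real k" if "i < k" for i
      unfolding tv_def using \<open>e > 0\<close> k that by (intro tv_distance_approx mix) auto
    then obtain A where A: "\<And>i. i < k \<Longrightarrow> A i \<in> sets ?N"
      and tv_le: "\<And>i. i < k \<Longrightarrow> tv i \<le> \<bar>measure (?mix i 1) (A i) - measure (?mix i (-1)) (A i)\<bar> + e / real k"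
      by metis
    define x where "x i = measure (?mix i 1) (A i) - measure (?mix i (-1)) (A i)" for i
    define d where "d z w i = measure (path_law (p z) w) (A i) - measure (path_law (p (flip z i)) w) (A i)" for z w i
    \<comment> \<open>Two signs are merged: the one that removes the absolute value for coordinate
      \<open>i\<close>, and the factor \<open>z i\<close> from
      \<open>conditional_mixture_diff\<close>.\<close>
    define c where "c z i = sgn (x i) * of_int (z i)" for z i
    have c: "\<bar>c z i\<bar> \<le> 1" if "z \<in> sign_cube k" "i < k" for z i
      using sign_cube_values[OF that] by (auto simp: c_def abs_mult abs_sgn_eq)
    have pointwise: "(\<Sum>i<k. c z i * d z w i) \<le> s" if z: "z \<in> sign_cube k" and w: "w \<in> space seeds" for z w
    proof -
      have "(\<Sum>i<k. ennreal ((d z w i)\<^sup>2)) \<le> 2 * (\<Sum>t<n. C t)"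
        unfolding d_def by (rule path_law_sum_TV_bound[OF w A]) (use z p C flip_sign_cube in auto)
      also have "\<dots> = ennreal (2 * b)"
        using b by (simp add: ennreal_mult)
      finally have sq: "(\<Sum>i<k. (d z w i)\<^sup>2) \<le> 2 * b"
        using b by (simp add: ennreal_le_iff)
      have "(\<Sum>i<k. c z i * d z w i) \<le> (\<Sum>i<k. \<bar>d z w i\<bar>)"
      proof (rule sum_mono)
        fix i assume "i \<in> {..<k}"
        then have "\<bar>c z i\<bar> * \<bar>d z w i\<bar> \<le> 1 * \<bar>d z w i\<bar>"
          using c[OF z] by (intro mult_right_mono) auto
        then show "c z i * d z w i \<le> \<bar>d z w i\<bar>"
          using abs_ge_self[of "c z i * d z w i"] by (simp add: abs_mult)
      qed
      also have "\<dots> \<le> s"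
        unfolding s_def
      proof (rule real_le_rsqrt)
        have "(\<Sum>i<k. \<bar>d z w i\<bar>)\<^sup>2 \<le> (\<Sum>i<k. \<bar>d z w i\<bar>\<^sup>2) * real (card {..<k})"
          by (rule sum_squared_le_sum_of_squares) 
        also have "\<dots> \<le> real k * (2 * b)"
          using sq by (simp add: mult.commute mult_left_mono)
        finally show "(\<Sum>i<k. \<bar>d z w i\<bar>)\<^sup>2 \<le> real k * (2 * b)" .
      qed
      finally show ?thesis .
    qed
    have inner: "(\<Sum>i<k. c z i * (measure (L z) (A i) - measure (L (flip z i)) (A i))) \<le> s"
      if z: "z \<in> sign_cube k" for z
    proof -
      interpret S: prob_space seeds by (rule prob_space_seeds)
      have int: "integrable seeds (\<lambda>w. d z w i)"
        and eq: "measure (L z) (A i) - measure (L (flip z i)) (A i) = (\<integral>w. d z w i \<partial>seeds)" if i: "i < k" for i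
      proof -
        note pz = p[OF z] and pf = p[OF flip_sign_cube[OF z i]]
        show "integrable seeds (\<lambda>w. d z w i)"
          unfolding d_def by (intro Bochner_Integration.integrable_diff integrable_path_law pz pf A i)
        show "measure (L z) (A i) - measure (L (flip z i)) (A i) = (\<integral>w. d z w i \<partial>seeds)"
          unfolding d_def L_def
          by (simp add: measure_output_law[OF pz A[OF i]] measure_output_law[OF pf A[OF i]]
              integrable_path_law[OF pz A[OF i]] integrable_path_law[OF pf A[OF i]])
      qed
      have "(\<Sum>i<k. c z i * (measure (L z) (A i) - measure (L (flip z i)) (A i)))
          = (\<integral>w. (\<Sum>i<k. c z i * d z w i) \<partial>seeds)"
        using int by (simp add: Bochner_Integration.integral_sum eq)
      also have "\<dots> \<le> (\<integral>w. s \<partial>seeds)"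
        using int by (intro integral_mono) (auto intro!: pointwise z)
      finally show ?thesis by (simp add: S.prob_space)
    qed
    have "(\<Sum>i<k. \<bar>x i\<bar>) = (\<Sum>i<k. sgn (x i) * x i)"
      by (intro sum.cong) (auto simp: abs_sgn mult.commute)
    also have "\<dots> = (\<Sum>i<k. \<Sum>z\<in>sign_cube k. pmf (rad_cube \<tau> k) z *
        (c z i * (measure (L z) (A i) - measure (L (flip z i)) (A i))))"
    proof (intro sum.cong refl)
      fix i assume "i \<in> {..<k}"
      then have i: "i < k" by simp
      have "x i = (\<Sum>z\<in>sign_cube k. pmf (rad_cube \<tau> k) z *
          (of_int (z i) * (measure (L z) (A i) - measure (L (flip z i)) (A i))))"
        unfolding x_def by (rule conditional_mixture_diff[OF \<tau> i L A[OF i]])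
      then have "r * x i = (\<Sum>z\<in>sign_cube k. pmf (rad_cube \<tau> k) z *
          (r * of_int (z i) * (measure (L z) (A i) - measure (L (flip z i)) (A i))))" for r
        by (simp add: sum_distrib_left mult_ac)
      then show "sgn (x i) * x i = (\<Sum>z\<in>sign_cube k. pmf (rad_cube \<tau> k) z *
          (c z i * (measure (L z) (A i) - measure (L (flip z i)) (A i))))"
        unfolding c_def .
    qed
    also have "\<dots> = (\<Sum>z\<in>sign_cube k. pmf (rad_cube \<tau> k) z *
        (\<Sum>i<k. c z i * (measure (L z) (A i) - measure (L (flip z i)) (A i))))"
      by (subst sum.swap) (simp add: sum_distrib_left)
    also have "\<dots> \<le> (\<Sum>z\<in>sign_cube k. pmf (rad_cube \<tau> k) z * s)"
      by (intro sum_mono mult_left_mono inner) auto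
    also have "\<dots> = s"
      by (simp add: wt flip: sum_distrib_right)
    finally have "(\<Sum>i<k. \<bar>x i\<bar>) \<le> s" .
    moreover have "(\<Sum>i<k. tv i) \<le> (\<Sum>i<k. \<bar>x i\<bar> + e / real k)"
      unfolding x_def by (intro sum_mono tv_le) simp
    ultimately show "(\<Sum>i<k. tv i) \<le> s + e"
      using k by (simp add: sum.distrib)
  qed
  moreover have "0 \<le> (\<Sum>i<k. tv i)"
    unfolding tv_def by (intro sum_nonneg tv_distance_nonneg[where N = ?N] mix) auto
  ultimately have "(\<Sum>i<k. tv i)\<^sup>2 \<le> s\<^sup>2"
    by (intro power_mono)
  also have "s\<^sup>2 = real k * (2 * b)"
    using b by (simp add: s_def)
  finally have "(1 / real k * (\<Sum>i<k. tv i))\<^sup>2 \<le> 2 / real k * b"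
    using k by (simp add: power_mult_distrib power_divide divide_simps power2_eq_square mult_ac)
  then have "ennreal ((1 / real k * (\<Sum>i<k. tv i))\<^sup>2) \<le> ennreal (2 / real k * b)"
    by (rule ennreal_leI)
  also have "\<dots> = ennreal (2 / real k) * (\<Sum>t<n. C t)"
    using b k by (simp add: ennreal_mult del: times_divide_eq_left)
  finally show ?thesis unfolding tv_def L_def .
qed

end

section \<open>Perturbed input distributions\<close>

text \<open>Expand the non-negative integral of (g - \<Sum> c i \<phi> i)^2 for the centred function
  g. Because the \<open>\<phi> i\<close> have mean zero, f and g have the same coefficients, so the
  variance appears instead of the second moment.\<close>

lemma (in prob_space) Bessel_ext_variance:
  fixes \<phi> :: "'i \<Rightarrow> 'a \<Rightarrow> real" and f :: "'a \<Rightarrow> real"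
  assumes I: "finite I" and [measurable]: "\<And>i. i \<in> I \<Longrightarrow> \<phi> i \<in> borel_measurable M"
    and orth: "\<And>i j. i \<in> I \<Longrightarrow> j \<in> I \<Longrightarrow> (\<integral>x. \<phi> i x * \<phi> j x \<partial>M) = (if i = j then 1 else 0)"
    and mean: "\<And>i. i \<in> I \<Longrightarrow> integrable M (\<phi> i)" "\<And>i. i \<in> I \<Longrightarrow> (\<integral>x. \<phi> i x \<partial>M) = 0"
    and f: "integrable M f" "\<And>i. i \<in> I \<Longrightarrow> integrable M (\<lambda>x. \<phi> i x * f x)"
  shows "ennreal (\<Sum>i\<in>I. (\<integral>x. \<phi> i x * f x \<partial>M)\<^sup>2) \<le> ext_variance M f"
proof (cases "ext_variance M f = \<infinity>")
  case False
  define m where "m = (\<integral>x. f x \<partial>M)"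
  define g where "g x = f x - m" for x
  define c where "c i = (\<integral>x. \<phi> i x * f x \<partial>M)" for i
  have [measurable]: "f \<in> borel_measurable M" using f by auto
  have [measurable]: "g \<in> borel_measurable M" unfolding g_def by measurable
  have int_g2: "integrable M (\<lambda>x. (g x)\<^sup>2)"
    using False unfolding ext_variance_def g_def m_def
    by (intro integrableI_nonneg) (auto simp: less_top)
  \<comment> \<open>The Bochner integral of a non-integrable function is 0, so the value 1 on the
    diagonal of \<open>orth\<close> yields integrability. The off-diagonal value 0 does not; mixed
    products are dominated by the sum of the squares.\<close>
  have int_sq: "integrable M (\<lambda>x. \<phi> i x * \<phi> i x)" if "i \<in> I" for i
    using orth[OF that that] not_integrable_integral_eq[of M "\<lambda>x. \<phi> i x * \<phi> i x"] by auto
  have int_\<phi>\<phi>: "integrable M (\<lambda>x. \<phi> i x * \<phi> j x)" if "i \<in> I" "j \<in> I" for i j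
  proof (rule Bochner_Integration.integrable_bound)
    show "integrable M (\<lambda>x. \<phi> i x * \<phi> i x + \<phi> j x * \<phi> j x)"
      using that by (intro Bochner_Integration.integrable_add int_sq)
    have "\<bar>x * y\<bar> \<le> x * x + y * y" for x y :: real
    proof -
      have "2 * (\<bar>x\<bar> * \<bar>y\<bar>) \<le> \<bar>x\<bar>\<^sup>2 + \<bar>y\<bar>\<^sup>2"
        using sum_squares_bound[of "\<bar>x\<bar>" "\<bar>y\<bar>"] by simp
      moreover have "0 \<le> \<bar>x\<bar> * \<bar>y\<bar>" by simp
      ultimately have "\<bar>x\<bar> * \<bar>y\<bar> \<le> \<bar>x\<bar>\<^sup>2 + \<bar>y\<bar>\<^sup>2" by linarith
      then show ?thesis by (simp add: abs_mult power2_eq_square)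
    qed
    then show "AE x in M. norm (\<phi> i x * \<phi> j x) \<le> norm (\<phi> i x * \<phi> i x + \<phi> j x * \<phi> j x)"
      by (intro AE_I2) (simp add: order_trans[OF _ abs_ge_self])
  qed (use that in measurable)
  have int_\<phi>g: "integrable M (\<lambda>x. \<phi> i x * g x)" and c_eq: "(\<integral>x. \<phi> i x * g x \<partial>M) = c i" if "i \<in> I" for i
    using f(2)[OF that] mean[OF that] by (simp_all add: g_def c_def right_diff_distrib)
  have "0 \<le> (\<integral>x. (g x - (\<Sum>i\<in>I. c i * \<phi> i x))\<^sup>2 \<partial>M)"
    by simp
  also have "(\<lambda>x. (g x - (\<Sum>i\<in>I. c i * \<phi> i x))\<^sup>2) =
      (\<lambda>x. (g x)\<^sup>2 - 2 * (\<Sum>i\<in>I. c i * (\<phi> i x * g x)) + (\<Sum>i\<in>I. \<Sum>j\<in>I. c i * (c j * (\<phi> i x * \<phi> j x))))"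
  proof (rule ext)
    fix x
    have "g x * (\<Sum>i\<in>I. c i * \<phi> i x) = (\<Sum>i\<in>I. c i * (\<phi> i x * g x))"
      by (simp add: sum_distrib_left mult_ac)
    moreover have "(\<Sum>i\<in>I. c i * \<phi> i x)\<^sup>2 = (\<Sum>i\<in>I. \<Sum>j\<in>I. c i * (c j * (\<phi> i x * \<phi> j x)))"
      by (simp add: power2_eq_square sum_product mult_ac)
    ultimately show "(g x - (\<Sum>i\<in>I. c i * \<phi> i x))\<^sup>2 =
        (g x)\<^sup>2 - 2 * (\<Sum>i\<in>I. c i * (\<phi> i x * g x)) + (\<Sum>i\<in>I. \<Sum>j\<in>I. c i * (c j * (\<phi> i x * \<phi> j x)))"
      by (simp add: power2_diff mult.assoc)
  qed
  also have "(\<integral>x. (g x)\<^sup>2 - 2 * (\<Sum>i\<in>I. c i * (\<phi> i x * g x)) + (\<Sum>i\<in>I. \<Sum>j\<in>I. c i * (c j * (\<phi> i x * \<phi> j x))) \<partial>M)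
      = (\<integral>x. (g x)\<^sup>2 \<partial>M) - 2 * (\<Sum>i\<in>I. c i * c i) + (\<Sum>i\<in>I. \<Sum>j\<in>I. c i * (c j * (if i = j then 1 else 0)))"
    using int_g2 int_\<phi>g int_\<phi>\<phi>
    by (simp add: Bochner_Integration.integral_add Bochner_Integration.integral_diff Bochner_Integration.integral_sum
        c_eq orth)
  also have "(\<Sum>i\<in>I. \<Sum>j\<in>I. c i * (c j * (if i = j then 1 else 0))) = (\<Sum>i\<in>I. c i * c i)"
    using I by (intro sum.cong refl) (simp add: if_distrib[of "\<lambda>x. _ * x"] cong: if_cong)
  finally have "(\<Sum>i\<in>I. (c i)\<^sup>2) \<le> (\<integral>x. (g x)\<^sup>2 \<partial>M)"
    by (simp add: power2_eq_square)
  then have "ennreal (\<Sum>i\<in>I. (c i)\<^sup>2) \<le> ennreal (\<integral>x. (g x)\<^sup>2 \<partial>M)"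
    by (rule ennreal_leI)
  also have "\<dots> = ext_variance M f"
    unfolding ext_variance_def g_def m_def using int_g2[unfolded g_def m_def]
    by (intro nn_integral_eq_integral[symmetric]) auto
  finally show ?thesis unfolding c_def .
qed auto

text \<open>The situation at one vertex \<open>z\<close> of the cube and for one channel:
  \<open>P\<close> stands for the distribution at \<open>z\<close>, \<open>Q i\<close> for the one
  at \<open>flip z i\<close>.\<close>

locale perturbed_inputs = input_channel P \<mu> V
  for P :: "'x measure" and \<mu> :: "'y measure" and V :: "'x \<Rightarrow> 'y \<Rightarrow> real" +
  fixes k :: nat and Q :: "nat \<Rightarrow> 'x measure" and a :: "nat \<Rightarrow> real" and \<phi> :: "nat \<Rightarrow> 'x \<Rightarrow> real" and \<alpha> :: real
  assumes Q_prob: "i < k \<Longrightarrow> prob_space (Q i)" and Q_sets: "i < k \<Longrightarrow> sets (Q i) = sets P"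
    and Q_ac: "i < k \<Longrightarrow> absolutely_continuous P (Q i)"
    and a_bound: "i < k \<Longrightarrow> \<bar>a i\<bar> \<le> \<alpha>"
    and \<phi>_meas: "i < k \<Longrightarrow> \<phi> i \<in> borel_measurable P"
    and Q_deriv: "i < k \<Longrightarrow> AE x in P. enn2real (RN_deriv P (Q i) x) = 1 + a i * \<phi> i x"
    and \<phi>_orth: "i < k \<Longrightarrow> j < k \<Longrightarrow> (\<integral>x. \<phi> i x * \<phi> j x \<partial>P) = (if i = j then 1 else 0)"
begin

lemma deriv_nonneg: "i < k \<Longrightarrow> AE x in P. 0 \<le> 1 + a i * \<phi> i x"
  using Q_deriv by (rule AE_mp) (auto intro!: AE_I2 simp: eq_commute[of "enn2real _"])

text \<open>The assumption concerns \<open>enn2real\<close> of the derivative, which sends infinity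
  to 0. The derivative is finite almost everywhere because \<open>Q i\<close> is sigma-finite, so
  its extended value can be recovered.\<close>

lemma Q_eq:
  assumes "i < k"
  shows "Q i = density P (\<lambda>x. ennreal (1 + a i * \<phi> i x))"
proof -
  interpret Q: prob_space "Q i" using assms by (rule Q_prob)
  note [measurable] = \<phi>_meas[OF assms]
  have sigma_finite_P: "sigma_finite_measure P"
    using prob_space_axioms by (rule prob_space_imp_sigma_finite)
  have "AE x in P. RN_deriv P (Q i) x \<noteq> \<infinity>"
    by (rule sigma_finite_measure.RN_deriv_finite[OF sigma_finite_P Q.sigma_finite_measure_axioms Q_ac[OF assms] Q_sets[OF assms]])
  with Q_deriv[OF assms] have "AE x in P. RN_deriv P (Q i) x = ennreal (1 + a i * \<phi> i x)"
  proof eventually_elim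
    case (elim x)
    then show ?case by (metis ennreal_enn2real infinity_ennreal_def less_top)
  qed
  then have "density P (RN_deriv P (Q i)) = density P (\<lambda>x. ennreal (1 + a i * \<phi> i x))"
    by (intro density_cong) auto
  then show ?thesis
    using sigma_finite_measure.density_RN_deriv[OF sigma_finite_P Q_ac[OF assms] Q_sets[OF assms]] by simp
qed

lemma
  fixes f :: "'x \<Rightarrow> real"
  assumes i: "i < k" and f [measurable]: "f \<in> borel_measurable P"
  shows integrable_Q_iff: "integrable (Q i) f \<longleftrightarrow> integrable P (\<lambda>x. (1 + a i * \<phi> i x) * f x)"
    and integral_Q: "(\<integral>x. f x \<partial>Q i) = (\<integral>x. (1 + a i * \<phi> i x) * f x \<partial>P)"
proof -
  note [measurable] = \<phi>_meas[OF i]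
  show "integrable (Q i) f \<longleftrightarrow> integrable P (\<lambda>x. (1 + a i * \<phi> i x) * f x)"
    unfolding Q_eq[OF i] using deriv_nonneg[OF i] by (subst integrable_density) auto
  show "(\<integral>x. f x \<partial>Q i) = (\<integral>x. (1 + a i * \<phi> i x) * f x \<partial>P)"
    unfolding Q_eq[OF i] using deriv_nonneg[OF i] by (subst integral_density) auto
qed

text \<open>\<open>Q i\<close> has mass one, so \<open>a i * \<phi> i\<close> has mean zero, and the
  factor can be divided out if it is nonzero. If \<open>a i = 0\<close>, the distributions
  \<open>Q i\<close> and \<open>P\<close> coincide and the coordinate contributes nothing; hence the
  index set \<open>{i. i < k \<and> a i \<noteq> 0}\<close> below.\<close>

lemma
  assumes i: "i < k" "a i \<noteq> 0"
  shows \<phi>_integrable: "integrable P (\<phi> i)" and \<phi>_mean: "(\<integral>x. \<phi> i x \<partial>P) = 0"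
proof -
  interpret Q: prob_space "Q i" using i by (intro Q_prob)
  have int: "integrable P (\<lambda>x. 1 + a i * \<phi> i x)"
    using integrable_Q_iff[OF i(1), of "\<lambda>_. 1"] by simp
  then have "integrable P (\<lambda>x. (1 + a i * \<phi> i x) - 1)"
    by (rule Bochner_Integration.integrable_diff) simp
  then show int_\<phi>: "integrable P (\<phi> i)" using i by simp
  have "(\<integral>x. 1 + a i * \<phi> i x \<partial>P) = 1"
    using integral_Q[OF i(1), of "\<lambda>_. 1"] Q.prob_space by simp
  then show "(\<integral>x. \<phi> i x \<partial>P) = 0" using int_\<phi> i by (simp add: prob_space)
qed

text \<open>For almost every output the channel is integrable under both \<open>P\<close> and
  \<open>Q i\<close>; subtracting the densities 1 and 1 + a i \<phi> i leaves the correlation with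
  \<open>\<phi> i\<close>. The factor \<open>a i\<close> stays inside the integrability claim so
  that \<open>a i = 0\<close> is covered.\<close>

lemma AE_mean_density_Q:
  assumes i: "i < k"
  shows "AE y in \<mu>. integrable P (\<lambda>x. a i * (\<phi> i x * V x y)) \<and>
    mean_density (Q i) V y - mean_density P V y = a i * (\<integral>x. \<phi> i x * V x y \<partial>P)"
proof -
  have "input_channel (Q i) \<mu> V"
    using channel unfolding channel_cong_sets[OF Q_sets[OF i], symmetric]
    by (intro input_channel.intro input_channel_axioms.intro Q_prob[OF i] sigma_finite_measure_axioms)
  then interpret Q: input_channel "Q i" \<mu> V .
  have "AE y in \<mu>. y \<in> space \<mu>" by simp
  with AE_integrable_V Q.AE_integrable_V show ?thesis
  proof eventually_elim
    case (elim y)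
    note [measurable] = V_meas1[OF elim(3)]
    have int: "integrable P (\<lambda>x. (1 + a i * \<phi> i x) * V x y)"
      using elim integrable_Q_iff[OF i, of "\<lambda>x. V x y"] by simp
    then have "integrable P (\<lambda>x. (1 + a i * \<phi> i x) * V x y - V x y)"
      using elim by (intro Bochner_Integration.integrable_diff)
    then have int': "integrable P (\<lambda>x. a i * (\<phi> i x * V x y))"
      by (simp add: distrib_right mult.assoc)
    have "mean_density (Q i) V y = (\<integral>x. V x y + a i * (\<phi> i x * V x y) \<partial>P)"
      unfolding mean_density_def using integral_Q[OF i, of "\<lambda>x. V x y"]
      by (simp add: distrib_right mult.assoc)
    also have "\<dots> = mean_density P V y + (\<integral>x. a i * (\<phi> i x * V x y) \<partial>P)"
      unfolding mean_density_def using elim int' by (intro Bochner_Integration.integral_add)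
    finally show ?case using int' by simp
  qed
qed

lemma mean_density_sq_diff_sum:
  "AE y in \<mu>. (\<forall>i\<in>{i. i < k \<and> a i \<noteq> 0}. integrable P (\<lambda>x. \<phi> i x * V x y)) \<and>
    (\<Sum>i<k. (mean_density (Q i) V y - mean_density P V y)\<^sup>2)
      \<le> \<alpha>\<^sup>2 * (\<Sum>i\<in>{i. i < k \<and> a i \<noteq> 0}. (\<integral>x. \<phi> i x * V x y \<partial>P)\<^sup>2)"
proof -
  let ?I = "{i. i < k \<and> a i \<noteq> 0}"
  have "AE y in \<mu>. \<forall>i\<in>{..<k}. integrable P (\<lambda>x. a i * (\<phi> i x * V x y)) \<and>
      mean_density (Q i) V y - mean_density P V y = a i * (\<integral>x. \<phi> i x * V x y \<partial>P)"
    by (rule AE_finite_allI[OF finite_lessThan]) (rule AE_mean_density_Q, simp only: lessThan_iff)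
  then show ?thesis
  proof eventually_elim
    case (elim y)
    have "(\<Sum>i<k. (mean_density (Q i) V y - mean_density P V y)\<^sup>2)
        = (\<Sum>i\<in>?I. (mean_density (Q i) V y - mean_density P V y)\<^sup>2)"
      using elim by (intro sum.mono_neutral_right) auto
    also have "\<dots> \<le> (\<Sum>i\<in>?I. \<alpha>\<^sup>2 * (\<integral>x. \<phi> i x * V x y \<partial>P)\<^sup>2)"
    proof (intro sum_mono)
      fix i assume "i \<in> ?I"
      then have i: "i < k" by simp
      have "(a i)\<^sup>2 \<le> \<alpha>\<^sup>2"
        using a_bound[OF i] by (rule abs_le_square_iff[THEN iffD1, OF order_trans]) simp
      then show "(mean_density (Q i) V y - mean_density P V y)\<^sup>2 \<le> \<alpha>\<^sup>2 * (\<integral>x. \<phi> i x * V x y \<partial>P)\<^sup>2"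
        using elim i by (auto simp: power_mult_distrib intro!: mult_right_mono)
    qed
    finally show ?case
      using elim by (auto simp: sum_distrib_left)
  qed
qed

lemma sum_chi_square:
  "(\<Sum>i<k. chi_square \<mu> (mean_density P V) (mean_density (Q i) V)) =
    (\<integral>\<^sup>+y. ennreal (\<Sum>i<k. (mean_density (Q i) V y - mean_density P V y)\<^sup>2) / ennreal (mean_density P V y) \<partial>\<mu>)"
proof -
  have [measurable]: "mean_density (Q i) V \<in> borel_measurable \<mu>" if "i < k" for i
  proof -
    have "input_channel (Q i) \<mu> V"
      using channel unfolding channel_cong_sets[OF Q_sets[OF that], symmetric]
      by (intro input_channel.intro input_channel_axioms.intro Q_prob[OF that] sigma_finite_measure_axioms)
    then show ?thesis by (rule input_channel.mean_density_meas)
  qed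
  show ?thesis
    unfolding chi_square_def
    by (subst nn_integral_sum[symmetric])
       (auto simp: divide_ennreal_def sum_distrib_right[symmetric] sum_nonneg)
qed

lemma sum_chi_square_le_variance:
  "(\<Sum>i<k. chi_square \<mu> (mean_density P V) (mean_density (Q i) V)) \<le>
    ennreal (\<alpha>\<^sup>2) * (\<integral>\<^sup>+y. ext_variance P (\<lambda>x. V x y) / ennreal (mean_density P V y) \<partial>\<mu>)"
proof -
  have [measurable]: "(\<lambda>y. ext_variance P (\<lambda>x. V x y)) \<in> borel_measurable \<mu>"
    unfolding ext_variance_def by measurable
  have "AE y in \<mu>. y \<in> space \<mu>" by simp
  with mean_density_sq_diff_sum AE_integrable_V
  have "AE y in \<mu>. ennreal (\<Sum>i<k. (mean_density (Q i) V y - mean_density P V y)\<^sup>2) / ennreal (mean_density P V y)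
      \<le> ennreal (\<alpha>\<^sup>2) * (ext_variance P (\<lambda>x. V x y) / ennreal (mean_density P V y))"
  proof eventually_elim
    case (elim y)
    have "ennreal (\<Sum>i<k. (mean_density (Q i) V y - mean_density P V y)\<^sup>2)
        \<le> ennreal (\<alpha>\<^sup>2 * (\<Sum>i\<in>{i. i < k \<and> a i \<noteq> 0}. (\<integral>x. \<phi> i x * V x y \<partial>P)\<^sup>2))"
      using elim by (intro ennreal_leI) simp
    also have "\<dots> = ennreal (\<alpha>\<^sup>2) * ennreal (\<Sum>i\<in>{i. i < k \<and> a i \<noteq> 0}. (\<integral>x. \<phi> i x * V x y \<partial>P)\<^sup>2)"
      by (intro ennreal_mult) (auto intro: sum_nonneg)
    also have "\<dots> \<le> ennreal (\<alpha>\<^sup>2) * ext_variance P (\<lambda>x. V x y)"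
      using elim by (intro mult_left_mono Bessel_ext_variance)
        (auto simp: \<phi>_meas \<phi>_orth \<phi>_integrable \<phi>_mean)
    finally show ?case
      unfolding ennreal_times_divide by (rule divide_right_mono_ennreal)
  qed
  then have "(\<integral>\<^sup>+y. ennreal (\<Sum>i<k. (mean_density (Q i) V y - mean_density P V y)\<^sup>2) / ennreal (mean_density P V y) \<partial>\<mu>)
      \<le> (\<integral>\<^sup>+y. ennreal (\<alpha>\<^sup>2) * (ext_variance P (\<lambda>x. V x y) / ennreal (mean_density P V y)) \<partial>\<mu>)"
    by (rule nn_integral_mono_AE)
  then show ?thesis
    unfolding sum_chi_square by (subst (asm) nn_integral_cmult) auto
qed

end

section \<open>Subgaussian perturbations and mutual information\<close>

text \<open>Young's inequality for exp and its convex conjugate u ln u - u: multiply exp x \<ge> 1 +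
  x at x = s - ln u by u.\<close>

lemma Fenchel_exp:
  fixes u s :: real
  assumes "0 \<le> u"
  shows "u * s \<le> u * ln u - u + exp s"
proof (cases "u = 0")
  case False
  then have u: "u > 0" using assms by simp
  have "u * (1 + (s - ln u)) \<le> u * exp (s - ln u)"
    using u exp_ge_add_one_self by (intro mult_left_mono) auto
  also have "\<dots> = exp s" using u by (simp add: exp_diff)
  finally show ?thesis by (simp add: algebra_simps)
qed simp

text \<open>Fenchel's inequality is applied with the linear form of slope \<open>w = c / s2\<close>, where \<open>c\<close> is the vector
  of the means of \<open>\<phi>\<close> under the density \<open>u\<close>.\<close>

lemma (in prob_space) subgaussian_transport:
  fixes \<phi> :: "'i \<Rightarrow> 'a \<Rightarrow> real" and u :: "'a \<Rightarrow> real"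
  assumes I: "finite I" and s2: "0 < s2"
    and mgf: "\<And>w. integrable M (\<lambda>x. exp (\<Sum>i\<in>I. w i * \<phi> i x))"
      "\<And>w. (\<integral>x. exp (\<Sum>i\<in>I. w i * \<phi> i x) \<partial>M) \<le> exp (s2 * (\<Sum>i\<in>I. (w i)\<^sup>2) / 2)"
    and u: "\<And>x. x \<in> space M \<Longrightarrow> 0 \<le> u x" "integrable M u" "(\<integral>x. u x \<partial>M) = 1"
      "integrable M (\<lambda>x. u x * ln (u x))" "\<And>i. i \<in> I \<Longrightarrow> integrable M (\<lambda>x. \<phi> i x * u x)"
  shows "(\<Sum>i\<in>I. (\<integral>x. \<phi> i x * u x \<partial>M)\<^sup>2) \<le> 2 * s2 * (\<integral>x. u x * ln (u x) \<partial>M)"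
proof -
  define c where "c i = (\<integral>x. \<phi> i x * u x \<partial>M)" for i
  define w where "w i = c i / s2" for i
  \<comment> \<open>The bound for the logarithm of the moment generating function at
    \<open>w\<close>. Subtracting it from the exponent makes the exponential have mean at most 1,
    which offsets the -1 coming from the mass of \<open>u\<close>.\<close>
  define r where "r = s2 * (\<Sum>i\<in>I. (w i)\<^sup>2) / 2"
  let ?e = "\<lambda>x. exp (\<Sum>i\<in>I. w i * \<phi> i x)"
  have "(\<integral>x. (\<Sum>i\<in>I. w i * (\<phi> i x * u x)) - r * u x \<partial>M) \<le> (\<integral>x. u x * ln (u x) - u x + exp (- r) * ?e x \<partial>M)"
  proof (rule integral_mono)
    fix x assume "x \<in> space M"
    have "(\<Sum>i\<in>I. w i * (\<phi> i x * u x)) - r * u x = u x * ((\<Sum>i\<in>I. w i * \<phi> i x) - r)"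
      by (simp add: right_diff_distrib sum_distrib_left mult_ac)
    also have "\<dots> \<le> u x * ln (u x) - u x + exp ((\<Sum>i\<in>I. w i * \<phi> i x) - r)"
      by (rule Fenchel_exp) (rule u(1), fact)
    also have "exp ((\<Sum>i\<in>I. w i * \<phi> i x) - r) = exp (- r) * ?e x"
      by (simp add: exp_diff exp_minus field_simps)
    finally show "(\<Sum>i\<in>I. w i * (\<phi> i x * u x)) - r * u x \<le> u x * ln (u x) - u x + exp (- r) * ?e x" .
  qed (use u mgf in \<open>auto intro!: Bochner_Integration.integrable_diff Bochner_Integration.integrable_add
      Bochner_Integration.integrable_sum\<close>)
  moreover have "(\<integral>x. (\<Sum>i\<in>I. w i * (\<phi> i x * u x)) - r * u x \<partial>M) = (\<Sum>i\<in>I. w i * c i) - r"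
    using u by (simp add: Bochner_Integration.integral_diff Bochner_Integration.integral_sum c_def)
  moreover have "(\<integral>x. u x * ln (u x) - u x + exp (- r) * ?e x \<partial>M) = (\<integral>x. u x * ln (u x) \<partial>M) - 1 + exp (- r) * (\<integral>x. ?e x \<partial>M)"
    using u mgf by (simp add: Bochner_Integration.integral_diff Bochner_Integration.integral_add)
  moreover have "exp (- r) * (\<integral>x. ?e x \<partial>M) \<le> 1"
  proof -
    have "exp (- r) * (\<integral>x. ?e x \<partial>M) \<le> exp (- r) * exp r"
      using mgf(2)[of w] by (intro mult_left_mono) (auto simp: r_def)
    then show ?thesis by (simp add: exp_minus_inverse mult.commute)
  qed
  ultimately have "(\<Sum>i\<in>I. w i * c i) - r \<le> (\<integral>x. u x * ln (u x) \<partial>M)"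
    by linarith
  \<comment> \<open>The slope c / s2 maximises the left side, a concave quadratic in
    \<open>w\<close>; this is its maximum.\<close>
  moreover have "(\<Sum>i\<in>I. w i * c i) - r = (\<Sum>i\<in>I. (c i)\<^sup>2) / (2 * s2)"
  proof -
    have "(\<Sum>i\<in>I. w i * c i) = (\<Sum>i\<in>I. (c i)\<^sup>2) / s2"
      by (simp add: w_def power2_eq_square sum_divide_distrib)
    moreover have "r = (\<Sum>i\<in>I. (c i)\<^sup>2) / (2 * s2)"
      using s2 by (simp add: r_def w_def power_divide sum_divide_distrib[symmetric] power2_eq_square)
    ultimately show ?thesis using s2 by (simp add: field_simps)
  qed
  ultimately have "(\<Sum>i\<in>I. (c i)\<^sup>2) / (2 * s2) \<le> (\<integral>x. u x * ln (u x) \<partial>M)"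
    by simp
  then show ?thesis
    using s2 by (simp add: c_def pos_divide_le_eq mult_ac)
qed

text \<open>A nonzero weight vector on \<open>I\<close>, extended by 0 to \<open>{..<k}\<close>, is
  its norm \<open>r\<close> times a unit vector, so the defining inequality is used with \<lambda> =
  \<open>r\<close>. The zero vector has no direction and is treated separately.\<close>

lemma (in prob_space) subgaussian_vector_mgf:
  assumes "subgaussian_vector s2 k M \<phi>" and I: "I \<subseteq> {..<k}"
  shows "integrable M (\<lambda>x. exp (\<Sum>i\<in>I. w i * \<phi> i x))"
    and "(\<integral>x. exp (\<Sum>i\<in>I. w i * \<phi> i x) \<partial>M) \<le> exp (s2 * (\<Sum>i\<in>I. (w i)\<^sup>2) / 2)"
proof -
  define r where "r = sqrt (\<Sum>i\<in>I. (w i)\<^sup>2)"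
  have fin: "finite I" using I by (rule finite_subset) simp
  have r2: "(\<Sum>i\<in>I. (w i)\<^sup>2) = r\<^sup>2"
    by (simp add: r_def sum_nonneg)
  have "integrable M (\<lambda>x. exp (\<Sum>i\<in>I. w i * \<phi> i x)) \<and>
    (\<integral>x. exp (\<Sum>i\<in>I. w i * \<phi> i x) \<partial>M) \<le> exp (s2 * r\<^sup>2 / 2)"
  proof (cases "r = 0")
    case True
    then have "\<forall>i\<in>I. w i = 0"
      using r2 fin by (simp add: sum_nonneg_eq_0_iff)
    then show ?thesis using True by (simp add: prob_space)
  next
    case False
    define v where "v i = (if i \<in> I then w i / r else 0)" for i
    have restrict: "(\<Sum>i<k. f i * v i) = (\<Sum>i\<in>I. f i * (w i / r))" for f :: "nat \<Rightarrow> real"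
      using I by (intro sum.mono_neutral_cong_right) (auto simp: v_def)
    have "(\<Sum>i<k. (v i)\<^sup>2) = (\<Sum>i\<in>I. v i * (w i / r))"
      unfolding power2_eq_square by (rule restrict)
    also have "\<dots> = (\<Sum>i\<in>I. (w i)\<^sup>2) / r\<^sup>2"
      unfolding sum_divide_distrib by (intro sum.cong) (auto simp: v_def power2_eq_square)
    finally have "(\<Sum>i<k. (v i)\<^sup>2) = 1"
      using False r2 by simp
    then have "integrable M (\<lambda>x. exp (r * (\<Sum>i<k. \<phi> i x * v i))) \<and>
        (\<integral>x. exp (r * (\<Sum>i<k. \<phi> i x * v i)) \<partial>M) \<le> exp (s2 * r\<^sup>2 / 2)"
      using assms(1) unfolding subgaussian_vector_def by blast
    moreover have "r * (\<Sum>i<k. \<phi> i x * v i) = (\<Sum>i\<in>I. w i * \<phi> i x)" for x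
      unfolding restrict sum_distrib_left using False by (intro sum.cong) auto
    ultimately show ?thesis by simp
  qed
  then show "integrable M (\<lambda>x. exp (\<Sum>i\<in>I. w i * \<phi> i x))"
    "(\<integral>x. exp (\<Sum>i\<in>I. w i * \<phi> i x) \<partial>M) \<le> exp (s2 * (\<Sum>i\<in>I. (w i)\<^sup>2) / 2)"
    by (auto simp: r2)
qed

text \<open>The function exp y - 1 - y is non-negative and vanishes only at y = 0. For parameter 0
  the mean of exp(\<phi> i) is at most 1 and that of \<open>\<phi> i\<close> is 0, so the mean of
  this function at \<open>\<phi> i\<close> is zero.\<close>

lemma (in prob_space) subgaussian_zero_variance:
  assumes sub: "subgaussian_vector 0 k M \<phi>" and i: "i < k" "\<phi> i \<in> borel_measurable M"
  shows "AE x in M. \<phi> i x = 0"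
proof -
  define v where "v j = (if j = i then 1 else 0 :: real)" for j
  have v: "(\<Sum>j<k. \<phi> j x * v j) = \<phi> i x" for x
    using i by (simp add: v_def if_distrib[of "\<lambda>y. _ * y"] cong: if_cong)
  have "(\<Sum>j<k. (v j)\<^sup>2) = 1"
    using i by (simp add: v_def if_distrib[of "\<lambda>x. x\<^sup>2"] cong: if_cong)
  note * = sub[unfolded subgaussian_vector_def, THEN spec, THEN mp, OF this, unfolded v]
  then have int: "integrable M (\<phi> i)" "(\<integral>x. \<phi> i x \<partial>M) = 0"
    and all: "\<forall>l. integrable M (\<lambda>x. exp (l * \<phi> i x)) \<and> (\<integral>x. exp (l * \<phi> i x) \<partial>M) \<le> exp (0 * l\<^sup>2 / 2)"
    by blast+
  have e: "integrable M (\<lambda>x. exp (\<phi> i x))" "(\<integral>x. exp (\<phi> i x) \<partial>M) \<le> 1"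
    using spec[OF all, of 1] by auto
  have int_f: "integrable M (\<lambda>x. exp (\<phi> i x) - 1 - \<phi> i x)"
    using e int by simp
  have nonneg: "0 \<le> exp y - 1 - y" for y :: real
    using exp_ge_add_one_self[of y] by linarith
  have "(\<integral>x. exp (\<phi> i x) - 1 - \<phi> i x \<partial>M) \<le> 0"
    using e int by (simp add: prob_space)
  moreover have "0 \<le> (\<integral>x. exp (\<phi> i x) - 1 - \<phi> i x \<partial>M)"
    by (intro integral_nonneg_AE AE_I2 nonneg)
  ultimately have "(\<integral>x. exp (\<phi> i x) - 1 - \<phi> i x \<partial>M) = 0"
    by linarith
  then have "AE x in M. exp (\<phi> i x) - 1 - \<phi> i x = 0"
    using integral_nonneg_eq_0_iff_AE[OF int_f] nonneg by simp
  then show ?thesis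
  proof eventually_elim
    case (elim x)
    then show ?case
      using ln_eq_minus_one[of "exp (\<phi> i x)"] by simp
  qed
qed

section \<open>Mutual information in terms of densities\<close>

context input_channel
begin

text \<open>With the two marginals computed below, both arguments of the divergence become densities
  with respect to the same product measure.\<close>

lemma input_output_law_eq: "input_output_law P \<mu> V = density (P \<Otimes>\<^sub>M \<mu>) (\<lambda>(x, y). ennreal (V x y))"
proof -
  have kernel: "(\<lambda>x. channel_kernel \<mu> V x) \<in> P \<rightarrow>\<^sub>M prob_algebra \<mu>"
    unfolding channel_kernel_def
    by (rule channel_kernel_prob_algebra) (auto intro: sigma_finite_measure_axioms V_mass)
  have ret: "(\<lambda>(x, y). return (P \<Otimes>\<^sub>M \<mu>) (x, y)) \<in> P \<Otimes>\<^sub>M \<mu> \<rightarrow>\<^sub>M prob_algebra (P \<Otimes>\<^sub>M \<mu>)"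
    using measurable_return_prob_space[of "P \<Otimes>\<^sub>M \<mu>"] by (simp add: case_prod_unfold)
  have step: "(\<lambda>x. channel_kernel \<mu> V x \<bind> (\<lambda>y. return (P \<Otimes>\<^sub>M \<mu>) (x, y))) \<in> P \<rightarrow>\<^sub>M prob_algebra (P \<Otimes>\<^sub>M \<mu>)"
    by (rule measurable_bind_prob_space2[OF kernel ret])
  show ?thesis
  proof (rule measure_eqI)
    show sets_eq: "sets (input_output_law P \<mu> V) = sets (density (P \<Otimes>\<^sub>M \<mu>) (\<lambda>(x, y). ennreal (V x y)))"
      unfolding input_output_law_def using sets_bind'[OF prob_algebra_self step] by simp
    fix A assume "A \<in> sets (input_output_law P \<mu> V)"
    then have A [measurable]: "A \<in> sets (P \<Otimes>\<^sub>M \<mu>)" using sets_eq by simp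
    have "emeasure (input_output_law P \<mu> V) A =
        (\<integral>\<^sup>+x. emeasure (channel_kernel \<mu> V x \<bind> (\<lambda>y. return (P \<Otimes>\<^sub>M \<mu>) (x, y))) A \<partial>P)"
      unfolding input_output_law_def by (rule emeasure_bind_prob_algebra[OF prob_algebra_self step A])
    also have "\<dots> = (\<integral>\<^sup>+x. \<integral>\<^sup>+y. ennreal (V x y) * indicator A (x, y) \<partial>\<mu> \<partial>P)"
    proof (rule nn_integral_cong)
      fix x assume x: "x \<in> space P"
      note [measurable] = V_meas2[OF x]
      have r: "(\<lambda>y. return (P \<Otimes>\<^sub>M \<mu>) (x, y)) \<in> \<mu> \<rightarrow>\<^sub>M prob_algebra (P \<Otimes>\<^sub>M \<mu>)"
        by (rule measurable_compose[OF measurable_Pair1'[OF x] measurable_return_prob_space])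
      have [measurable]: "(\<lambda>y. indicator A (x, y) :: ennreal) \<in> borel_measurable \<mu>"
        using measurable_compose[OF measurable_Pair1'[OF x] borel_measurable_indicator[OF A]] .
      have "emeasure (channel_kernel \<mu> V x \<bind> (\<lambda>y. return (P \<Otimes>\<^sub>M \<mu>) (x, y))) A =
          (\<integral>\<^sup>+y. emeasure (return (P \<Otimes>\<^sub>M \<mu>) (x, y)) A \<partial>channel_kernel \<mu> V x)"
        by (rule emeasure_bind_prob_algebra[OF measurable_space[OF kernel x] r A])
      also have "\<dots> = (\<integral>\<^sup>+y. ennreal (V x y) * indicator A (x, y) \<partial>\<mu>)"
        using A by (simp add: channel_kernel_def nn_integral_density)
      finally show "emeasure (channel_kernel \<mu> V x \<bind> (\<lambda>y. return (P \<Otimes>\<^sub>M \<mu>) (x, y))) A =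
          (\<integral>\<^sup>+y. ennreal (V x y) * indicator A (x, y) \<partial>\<mu>)" .
    qed
    also have "\<dots> = emeasure (density (P \<Otimes>\<^sub>M \<mu>) (\<lambda>(x, y). ennreal (V x y))) A"
      by (simp add: emeasure_density nn_integral_fst[symmetric])
    finally show "emeasure (input_output_law P \<mu> V) A = emeasure (density (P \<Otimes>\<^sub>M \<mu>) (\<lambda>(x, y). ennreal (V x y))) A" .
  qed
qed

lemma distr_fst_input_output_law: "distr (input_output_law P \<mu> V) P fst = P"
proof (rule measure_eqI)
  fix A assume "A \<in> sets (distr (input_output_law P \<mu> V) P fst)"
  then have [measurable]: "A \<in> sets P" by simp
  have "emeasure (distr (input_output_law P \<mu> V) P fst) A =
      (\<integral>\<^sup>+z. ennreal (V (fst z) (snd z)) * indicator A (fst z) \<partial>(P \<Otimes>\<^sub>M \<mu>))"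
    unfolding input_output_law_eq
    by (subst emeasure_distr) (auto simp: emeasure_density case_prod_unfold space_pair_measure
        intro!: nn_integral_cong split: split_indicator)
  also have "\<dots> = (\<integral>\<^sup>+x. \<integral>\<^sup>+y. ennreal (V x y) * indicator A x \<partial>\<mu> \<partial>P)"
    by (subst nn_integral_fst[symmetric]) auto
  also have "\<dots> = (\<integral>\<^sup>+x. indicator A x \<partial>P)"
    by (intro nn_integral_cong) (simp add: nn_integral_multc V_mass)
  finally show "emeasure (distr (input_output_law P \<mu> V) P fst) A = emeasure P A"
    by simp
qed simp

lemma distr_snd_input_output_law:
  "distr (input_output_law P \<mu> V) \<mu> snd = density \<mu> (\<lambda>y. ennreal (mean_density P V y))"
proof (rule measure_eqI)
  fix A assume "A \<in> sets (distr (input_output_law P \<mu> V) \<mu> snd)"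
  then have [measurable]: "A \<in> sets \<mu>" by simp
  have "emeasure (distr (input_output_law P \<mu> V) \<mu> snd) A =
      (\<integral>\<^sup>+z. ennreal (V (fst z) (snd z)) * indicator A (snd z) \<partial>(P \<Otimes>\<^sub>M \<mu>))"
    unfolding input_output_law_eq
    by (subst emeasure_distr) (auto simp: emeasure_density case_prod_unfold space_pair_measure
        intro!: nn_integral_cong split: split_indicator)
  also have "\<dots> = (\<integral>\<^sup>+y. \<integral>\<^sup>+x. ennreal (V x y) * indicator A y \<partial>P \<partial>\<mu>)"
    by (subst pair.nn_integral_snd[symmetric]) auto
  also have "\<dots> = (\<integral>\<^sup>+y. (\<integral>\<^sup>+x. ennreal (V x y) \<partial>P) * indicator A y \<partial>\<mu>)"
    by (intro nn_integral_cong nn_integral_multc) simp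
  also have "\<dots> = (\<integral>\<^sup>+y. ennreal (mean_density P V y) * indicator A y \<partial>\<mu>)"
    using AE_mean_density by (intro nn_integral_cong_AE) auto
  finally show "emeasure (distr (input_output_law P \<mu> V) \<mu> snd) A
      = emeasure (density \<mu> (\<lambda>y. ennreal (mean_density P V y))) A"
    by (simp add: emeasure_density)
qed simp

lemma AE_eq_0_of_mean_density:
  assumes y: "y \<in> space \<mu>" and eq: "(\<integral>\<^sup>+x. ennreal (V x y) \<partial>P) = ennreal (mean_density P V y)"
    and "mean_density P V y = 0"
  shows "AE x in P. V x y = 0"
proof -
  note [measurable] = V_meas1[OF y]
  have "(\<integral>\<^sup>+x. ennreal (V x y) \<partial>P) = 0" using eq assms(3) by simp
  then have "AE x in P. ennreal (V x y) = 0"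
    by (subst (asm) nn_integral_0_iff_AE) auto
  with AE_space show ?thesis
  proof eventually_elim
    case (elim x)
    then show ?case using V_nonneg[OF elim(1) y] by (simp add: ennreal_eq_0_iff)
  qed
qed

text \<open>The density form of absolute continuity of the joint law with respect to the product of
  its marginals: a non-negative function with mean zero vanishes almost surely. The argument fixes
  the output first, hence the exchange of the two quantifiers.\<close>

lemma AE_zero_mean_density: "AE z in P \<Otimes>\<^sub>M \<mu>. mean_density P V (snd z) = 0 \<longrightarrow> V (fst z) (snd z) = 0"
proof -
  have "AE y in \<mu>. AE x in P. mean_density P V y = 0 \<longrightarrow> V x y = 0"
  proof -
    have "AE y in \<mu>. y \<in> space \<mu>" by simp
    with AE_mean_density show ?thesis
    proof eventually_elim
      case (elim y)
      note [measurable] = V_meas1[OF elim(2)]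
      show ?case
      proof (cases "mean_density P V y = 0")
        case True
        with AE_eq_0_of_mean_density[OF elim(2) elim(1)] show ?thesis by simp
      qed simp
    qed
  qed
  then have "AE x in P. AE y in \<mu>. mean_density P V y = 0 \<longrightarrow> V x y = 0"
    by (subst pair.AE_commute) auto
  then show ?thesis
    by (intro pair.AE_pair_measure) auto
qed

text \<open>A finite value means that the first branch of \<open>ext_KL_divergence\<close> applies,
  which supplies integrability of the entropy density. Identifying the Radon-Nikodym derivative with
  V x y / \<open>mean_density P V y\<close> carries this integrability over to the explicit
  integrand.\<close>

lemma channel_information_finite:
  assumes "channel_information P \<mu> V \<noteq> \<infinity>"
  shows "integrable (P \<Otimes>\<^sub>M \<mu>) (\<lambda>(x, y). V x y * log 2 (V x y / mean_density P V y))"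
    and "channel_information P \<mu> V =
      ennreal (\<integral>z. (case z of (x, y) \<Rightarrow> V x y * log 2 (V x y / mean_density P V y)) \<partial>(P \<Otimes>\<^sub>M \<mu>))"
proof -
  let ?g = "\<lambda>z. mean_density P V (snd z)" and ?v = "\<lambda>z. V (fst z) (snd z)"
  let ?PM = "P \<Otimes>\<^sub>M \<mu>"
  let ?M = "density ?PM (\<lambda>z. ennreal (?g z))" and ?J = "density ?PM (\<lambda>z. ennreal (?v z))"
  have g: "?g \<in> borel_measurable ?PM" "AE z in ?PM. 0 \<le> ?g z"
    by (measurable, auto intro!: AE_I2 mean_density_nonneg simp: space_pair_measure)
  have v: "?v \<in> borel_measurable ?PM" "AE z in ?PM. 0 \<le> ?v z"
    by (measurable, auto intro!: AE_I2 V_nonneg simp: space_pair_measure)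
  note [measurable] = g(1) v(1)
  have J: "input_output_law P \<mu> V = ?J"
    by (simp add: input_output_law_eq case_prod_unfold)
  interpret Y: prob_space "density \<mu> (\<lambda>y. ennreal (mean_density P V y))"
    by (intro prob_spaceI) (simp add: emeasure_density mean_density_mass cong: nn_integral_cong)
  have "P \<Otimes>\<^sub>M density \<mu> (\<lambda>y. ennreal (mean_density P V y)) =
      density P (\<lambda>_. 1) \<Otimes>\<^sub>M density \<mu> (\<lambda>y. ennreal (mean_density P V y))"
    by (simp add: density_1)
  also have "\<dots> = density ?PM (\<lambda>(x, y). 1 * ennreal (mean_density P V y))"
    by (rule pair_measure_density) (auto intro: sigma_finite_measure_axioms Y.sigma_finite_measure_axioms)
  finally have M: "distr ?J P fst \<Otimes>\<^sub>M distr ?J \<mu> snd = ?M"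
    unfolding J[symmetric] distr_fst_input_output_law distr_snd_input_output_law
    by (simp add: case_prod_unfold)
  interpret pair_prob: pair_prob_space P "density \<mu> (\<lambda>y. ennreal (mean_density P V y))" ..
  have sig_M: "sigma_finite_measure ?M"
    using pair_prob.P.sigma_finite_measure_axioms M
    unfolding J[symmetric] distr_fst_input_output_law distr_snd_input_output_law by simp
  have I: "channel_information P \<mu> V = ext_KL_divergence 2 ?M ?J"
    unfolding channel_information_def Let_def J M ..
  with assms have ac: "absolutely_continuous ?M ?J" and int: "integrable ?J (entropy_density 2 ?M ?J)"
    and I': "channel_information P \<mu> V = ennreal (KL_divergence 2 ?M ?J)"
    by (auto simp: ext_KL_divergence_def split: if_splits)
  have KL: "KL_divergence 2 ?M ?J = (\<integral>z. ?v z * log 2 (?v z / ?g z) \<partial>?PM)"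
    by (rule pair.KL_density_density) (use g v AE_zero_mean_density in auto)
  show "channel_information P \<mu> V =
      ennreal (\<integral>z. (case z of (x, y) \<Rightarrow> V x y * log 2 (V x y / mean_density P V y)) \<partial>?PM)"
    using I' KL by (simp add: case_prod_unfold)
  have J_div: "?J = density ?M (\<lambda>z. ennreal (?v z / ?g z))"
    using g v AE_zero_mean_density by (subst density_density_divide) auto
  have "AE z in ?M. ennreal (?v z / ?g z) = RN_deriv ?M ?J z"
    by (rule sigma_finite_measure.RN_deriv_unique[OF sig_M]) (use J_div in auto)
  then have "AE z in ?PM. 0 < ?g z \<longrightarrow> ennreal (?v z / ?g z) = RN_deriv ?M ?J z"
    by (subst (asm) AE_density) auto
  \<comment> \<open>Uniqueness of the derivative holds almost everywhere for \<open>?M\<close> only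
    and gives no information where the mean density vanishes. There \<open>?v\<close> is zero almost
    everywhere, so both products are 0.\<close>
  with g(2) v(2) AE_zero_mean_density
  have "AE z in ?PM. ?v z * entropy_density 2 ?M ?J z = ?v z * log 2 (?v z / ?g z)"
  proof eventually_elim
    case (elim z)
    show ?case
    proof (cases "?g z = 0")
      case False
      then have "0 < ?g z" using elim by simp
      with elim have "RN_deriv ?M ?J z = ennreal (?v z / ?g z)" by simp
      then show ?thesis using elim by (simp add: entropy_density_def)
    qed (use elim in simp)
  qed
  moreover have "integrable ?PM (\<lambda>z. ?v z * entropy_density 2 ?M ?J z)"
    using int v by (subst (asm) integrable_density) auto
  moreover have "entropy_density 2 ?M ?J \<in> borel_measurable ?PM"
    using borel_measurable_integrable[OF int] by simp
  ultimately have "integrable ?PM (\<lambda>z. ?v z * log 2 (?v z / ?g z))"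
    by (subst (asm) integrable_cong_AE) auto
  then show "integrable ?PM (\<lambda>(x, y). V x y * log 2 (V x y / mean_density P V y))"
    by (simp add: case_prod_unfold)
qed

end

section \<open>Information bound through the posterior of the input\<close>

context perturbed_inputs
begin

text \<open>For an output y of positive mean density, u = V(., y) / g(y) is the density of the
  posterior of the input with respect to \<open>P\<close>. The chi-square integrand at y is at most
  \<alpha>^2 g(y) times the sum of the squared posterior means of the \<open>\<phi> i\<close>;
  \<open>subgaussian_transport\<close> bounds that sum by 2 \<sigma>^2 times the divergence of the
  posterior from \<open>P\<close>, and integrating over y produces the mutual information.\<close>

lemma sum_chi_square_le_information:
  assumes k: "0 < k" and sub: "subgaussian_vector (\<sigma>\<^sup>2) k P \<phi>"
  shows "(\<Sum>i<k. chi_square \<mu> (mean_density P V) (mean_density (Q i) V)) \<le>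
    ennreal (2 * ln 2 * \<alpha>\<^sup>2 * \<sigma>\<^sup>2) * channel_information P \<mu> V"
proof -
  \<comment> \<open>A vanishing parameter would force \<open>\<phi> 0\<close> to be 0 almost surely,
    against its unit second moment. Positivity is needed for the transport inequality and in the
    case of infinite information.\<close>
  have "\<sigma>\<^sup>2 \<noteq> 0"
  proof
    assume "\<sigma>\<^sup>2 = 0"
    then have "AE x in P. \<phi> 0 x = 0"
      using subgaussian_zero_variance[of k \<phi> 0] sub k \<phi>_meas by simp
    then have "AE x in P. \<phi> 0 x * \<phi> 0 x = 0"
      by eventually_elim simp
    then have "(\<integral>x. \<phi> 0 x * \<phi> 0 x \<partial>P) = 0"
      by (rule integral_eq_zero_AE)
    then show False using \<phi>_orth[of 0 0] k by simp
  qed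
  then have s2: "0 < \<sigma>\<^sup>2" by simp
  \<comment> \<open>In \<open>ennreal\<close> the product of 0 and infinity is 0, so infinite
    information makes the bound trivial only when the factor is nonzero. For \<alpha> = 0 the
    variance bound already gives 0.\<close>
  consider "\<alpha> = 0" | "\<alpha> \<noteq> 0" "channel_information P \<mu> V = \<infinity>" | "channel_information P \<mu> V \<noteq> \<infinity>"
    by blast
  then show ?thesis
  proof cases
    case 1
    then show ?thesis using sum_chi_square_le_variance by simp
  next
    case 2
    then show ?thesis using s2 by (simp add: ennreal_mult_eq_top_iff)
  next
    case 3
    let ?I = "{i. i < k \<and> a i \<noteq> 0}"
    let ?g = "mean_density P V"
    \<comment> \<open>The contribution of output \<open>y\<close> to the mutual information:
      \<open>?g y\<close> times the divergence, in bits, of the posterior from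
      \<open>P\<close>.\<close>
    define \<psi> where "\<psi> y = (\<integral>x. V x y * log 2 (V x y / ?g y) \<partial>P)" for y
    define c where "c = 2 * ln 2 * \<alpha>\<^sup>2 * \<sigma>\<^sup>2"
    have c: "0 \<le> c" by (simp add: c_def)
    note info = channel_information_finite[OF 3]
    have "AE y in \<mu>. integrable P (\<lambda>x. V x y * log 2 (V x y / ?g y))"
      by (rule pair.AE_integrable_snd[OF info(1)])
    moreover have "AE y in \<mu>. y \<in> space \<mu>" by simp
    ultimately have "AE y in \<mu>. 0 \<le> c * \<psi> y \<and>
        ennreal (\<Sum>i<k. (mean_density (Q i) V y - ?g y)\<^sup>2) / ennreal (?g y) \<le> ennreal (c * \<psi> y)"
      using mean_density_sq_diff_sum AE_integrable_V AE_mean_density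
    proof eventually_elim
      case (elim y)
      note [measurable] = V_meas1[OF elim(2)]
      let ?D = "\<Sum>i<k. (mean_density (Q i) V y - ?g y)\<^sup>2"
      show ?case
      proof (cases "?g y = 0")
        case True
        then have V0: "AE x in P. V x y = 0"
          using elim by (intro AE_eq_0_of_mean_density)
        have "(\<integral>x. \<phi> i x * V x y \<partial>P) = 0" for i
        proof (rule integral_eq_zero_AE)
          show "AE x in P. \<phi> i x * V x y = 0"
            using V0 by eventually_elim simp
        qed
        then have "?D \<le> 0" using elim by simp
        then have "?D = 0" by (intro antisym sum_nonneg) auto
        \<comment> \<open>Default values: division by 0 yields 0 and \<open>ln 0 = 0\<close>, so the
          integrand is identically 0.\<close>
        moreover have "\<psi> y = 0"
          by (simp add: \<psi>_def True log_def)
        ultimately show ?thesis by simp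
      next
        case False
        then have g: "0 < ?g y" using mean_density_nonneg[OF elim(2)] by simp
        define u where "u x = V x y / ?g y" for x
        have ln_u: "u x * ln (u x) = ln 2 / ?g y * (V x y * log 2 (V x y / ?g y))" for x
          by (simp add: u_def log_def)
        have int_u: "integrable P (\<lambda>x. \<phi> i x * u x)" if "i \<in> ?I" for i
          using elim that by (simp add: u_def)
        have "(\<Sum>i\<in>?I. (\<integral>x. \<phi> i x * u x \<partial>P)\<^sup>2) \<le> 2 * \<sigma>\<^sup>2 * (\<integral>x. u x * ln (u x) \<partial>P)"
        proof (rule subgaussian_transport)
          show "(\<integral>x. u x \<partial>P) = 1" "integrable P u"
            using elim g by (simp_all add: u_def[abs_def] mean_density_def)
          show "integrable P (\<lambda>x. u x * ln (u x))"
            unfolding ln_u using elim by simp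
          show "0 \<le> u x" if "x \<in> space P" for x
            using V_nonneg[OF that elim(2)] g by (simp add: u_def)
          show "integrable P (\<lambda>x. exp (\<Sum>i\<in>?I. w i * \<phi> i x))"
            "(\<integral>x. exp (\<Sum>i\<in>?I. w i * \<phi> i x) \<partial>P) \<le> exp (\<sigma>\<^sup>2 * (\<Sum>i\<in>?I. (w i)\<^sup>2) / 2)" for w
            by (rule subgaussian_vector_mgf[OF sub]; auto)+
        qed (use s2 int_u in auto)
        also have "(\<integral>x. u x * ln (u x) \<partial>P) = ln 2 / ?g y * \<psi> y"
          unfolding ln_u \<psi>_def by simp
        also have "(\<Sum>i\<in>?I. (\<integral>x. \<phi> i x * u x \<partial>P)\<^sup>2) = (\<Sum>i\<in>?I. (\<integral>x. \<phi> i x * V x y \<partial>P)\<^sup>2) / (?g y)\<^sup>2"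
          by (simp add: u_def power_divide sum_divide_distrib)
        finally have "(\<Sum>i\<in>?I. (\<integral>x. \<phi> i x * V x y \<partial>P)\<^sup>2) \<le> 2 * \<sigma>\<^sup>2 * ln 2 * \<psi> y * ?g y"
          using g by (simp add: field_simps power2_eq_square)
        then have "\<alpha>\<^sup>2 * (\<Sum>i\<in>?I. (\<integral>x. \<phi> i x * V x y \<partial>P)\<^sup>2) \<le> \<alpha>\<^sup>2 * (2 * \<sigma>\<^sup>2 * ln 2 * \<psi> y * ?g y)"
          by (rule mult_left_mono) simp
        with elim have "?D \<le> c * \<psi> y * ?g y"
          by (simp add: c_def mult_ac)
        then have D: "?D / ?g y \<le> c * \<psi> y"
          using g by (simp add: pos_divide_le_eq)
        \<comment> \<open>The sign of \<open>c * \<psi> y\<close> is read off from the bound itself,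
          which lies above a non-negative quotient; Jensen's inequality is avoided.\<close>
        moreover have "0 \<le> ?D / ?g y"
          using g by (simp add: sum_nonneg)
        ultimately have "0 \<le> c * \<psi> y"
          by linarith
        with D show ?thesis
          using g by (simp add: divide_ennreal sum_nonneg ennreal_leI)
      qed
    qed
    then have AE: "AE y in \<mu>. 0 \<le> c * \<psi> y"
      "AE y in \<mu>. ennreal (\<Sum>i<k. (mean_density (Q i) V y - ?g y)\<^sup>2) / ennreal (?g y) \<le> ennreal (c * \<psi> y)"
      by auto
    have int: "integrable \<mu> (\<lambda>y. c * \<psi> y)"
      unfolding \<psi>_def using pair.integrable_snd[OF info(1)] by simp
    have "(\<Sum>i<k. chi_square \<mu> ?g (mean_density (Q i) V)) \<le> (\<integral>\<^sup>+y. ennreal (c * \<psi> y) \<partial>\<mu>)"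
      unfolding sum_chi_square using AE(2) by (rule nn_integral_mono_AE)
    also have "\<dots> = ennreal (\<integral>y. c * \<psi> y \<partial>\<mu>)"
      by (rule nn_integral_eq_integral[OF int AE(1)])
    also have "(\<integral>y. c * \<psi> y \<partial>\<mu>) = c * (\<integral>z. (case z of (x, y) \<Rightarrow> V x y * log 2 (V x y / ?g y)) \<partial>(P \<Otimes>\<^sub>M \<mu>))"
      unfolding \<psi>_def using pair.integral_snd[OF info(1)] by simp
    also have "ennreal \<dots> = ennreal c * channel_information P \<mu> V"
      using c by (simp add: info(2) ennreal_mult')
    finally show ?thesis by (simp add: c_def)
  qed
qed

end

theorem theorem2:
  fixes k n :: nat and \<tau> \<alpha> :: real
    and X :: "'x measure" and \<mu> :: "'y measure"
    and p :: "(nat \<Rightarrow> int) \<Rightarrow> 'x measure"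
    and a :: "(nat \<Rightarrow> int) \<Rightarrow> nat \<Rightarrow> real"
    and \<phi> :: "(nat \<Rightarrow> int) \<Rightarrow> nat \<Rightarrow> 'x \<Rightarrow> real"
    and \<W> :: "nat \<Rightarrow> ('x \<Rightarrow> 'y \<Rightarrow> real) set"
    and PU :: "'u measure" and PV :: "nat \<Rightarrow> 'v measure"
    and G :: "nat \<Rightarrow> 'u \<Rightarrow> 'v \<Rightarrow> (nat \<Rightarrow> 'y) \<Rightarrow> 'x \<Rightarrow> 'y \<Rightarrow> real"
  assumes k: "1 \<le> k" and \<tau>: "0 < \<tau>" "\<tau> \<le> 1/2"
    and \<mu>: "sigma_finite_measure \<mu>"
    and p_prob: "\<And>z. z \<in> sign_cube k \<Longrightarrow> prob_space (p z)"
    and p_sets: "\<And>z. z \<in> sign_cube k \<Longrightarrow> sets (p z) = sets X"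
    and A1_ac: "\<And>z i. z \<in> sign_cube k \<Longrightarrow> i < k \<Longrightarrow> absolutely_continuous (p z) (p (flip z i))"
    and A1_bound: "\<And>z i. z \<in> sign_cube k \<Longrightarrow> i < k \<Longrightarrow> \<bar>a z i\<bar> \<le> \<alpha>"
    and A1_meas: "\<And>z i. z \<in> sign_cube k \<Longrightarrow> i < k \<Longrightarrow> \<phi> z i \<in> borel_measurable X"
    and A1_deriv: "\<And>z i. z \<in> sign_cube k \<Longrightarrow> i < k \<Longrightarrow>
        AE x in p z. enn2real (RN_deriv (p z) (p (flip z i)) x) = 1 + a z i * \<phi> z i x"
    and A2: "\<And>z i j. z \<in> sign_cube k \<Longrightarrow> i < k \<Longrightarrow> j < k \<Longrightarrow>
        (\<integral>x. \<phi> z i x * \<phi> z j x \<partial>p z) = (if i = j then 1 else 0)"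
    and channels: "\<And>t V. t < n \<Longrightarrow> V \<in> \<W> t \<Longrightarrow> channel X \<mu> V"
    and protocol: "interactive_protocol X \<mu> n \<W> PU PV G"
  shows
    "ennreal ((1 / real k * (\<Sum>i<k. tv_distance
          (conditional_mixture \<tau> k i 1 (\<lambda>z. output_law \<mu> n PU PV G (p z)))
          (conditional_mixture \<tau> k i (-1) (\<lambda>z. output_law \<mu> n PU PV G (p z)))))\<^sup>2)
      \<le> ennreal (7 / real k * \<alpha>\<^sup>2) *
         (\<Sum>t<n. SUP z\<in>sign_cube k. SUP V\<in>\<W> t.
            \<integral>\<^sup>+y. ext_variance (p z) (\<lambda>x. V x y) / ennreal (\<integral>x. V x y \<partial>p z) \<partial>\<mu>)
     \<and> (\<forall>\<sigma>\<ge>0.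
          (\<forall>z\<in>sign_cube k.
             subgaussian_vector (\<sigma>\<^sup>2) k (p z) (\<phi> z) \<and>
             prob_space.indep_vars (p z) (\<lambda>_. borel) (\<phi> z) {..<k}) \<longrightarrow>
          ennreal ((1 / real k * (\<Sum>i<k. tv_distance
              (conditional_mixture \<tau> k i 1 (\<lambda>z. output_law \<mu> n PU PV G (p z)))
              (conditional_mixture \<tau> k i (-1) (\<lambda>z. output_law \<mu> n PU PV G (p z)))))\<^sup>2)
            \<le> ennreal (14 * ln 2 / real k * \<alpha>\<^sup>2 * \<sigma>\<^sup>2) *
               (\<Sum>t<n. SUP z\<in>sign_cube k. SUP V\<in>\<W> t. channel_information (p z) \<mu> V))"
proof -
  interpret protocol_setup X \<mu> n \<W> PU PV G
    by (intro protocol_setup.intro \<mu> channels protocol)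
  have perturbed: "perturbed_inputs (p z) \<mu> V k (\<lambda>i. p (flip z i)) (a z) (\<phi> z) \<alpha>"
    if z: "z \<in> sign_cube k" and "t < n" "V \<in> \<W> t" for z t V
  proof (intro perturbed_inputs.intro perturbed_inputs_axioms.intro input_channel.intro input_channel_axioms.intro)
    show "channel (p z) \<mu> V"
      unfolding channel_cong_sets[OF p_sets[OF z]] using that by (intro channels)
    fix i assume i: "i < k"
    note f = flip_sign_cube[OF z i]
    show "prob_space (p (flip z i))" "sets (p (flip z i)) = sets (p z)"
      using p_prob[OF f] p_sets[OF f] p_sets[OF z] by auto
    show "\<phi> z i \<in> borel_measurable (p z)"
      unfolding measurable_cong_sets[OF p_sets[OF z] refl] by (rule A1_meas[OF z i])
  qed (use z p_prob \<mu> A1_ac A1_bound A1_deriv A2 in auto)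
  let ?chi = "\<lambda>z V. \<Sum>i<k. chi_square \<mu> (mean_density (p z) V) (mean_density (p (flip z i)) V)"
  let ?tv = "\<Sum>i<k. tv_distance
      (conditional_mixture \<tau> k i 1 (\<lambda>z. output_law \<mu> n PU PV G (p z)))
      (conditional_mixture \<tau> k i (-1) (\<lambda>z. output_law \<mu> n PU PV G (p z)))"
  \<comment> \<open>Both claims are instances. The variance bound takes c = \<alpha>^2, where 2
    \<le> 7 is used; the information bound takes c = 2 ln 2 \<alpha>^2 \<sigma>^2, where 4 \<le> 14
    is used.\<close>
  have main: "ennreal ((1 / real k * ?tv)\<^sup>2) \<le>
      ennreal d * (\<Sum>t<n. SUP z\<in>sign_cube k. SUP V\<in>\<W> t. I z V)"
    if c: "0 \<le> c" "2 / real k * c \<le> d"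
      and I: "\<And>z t V. z \<in> sign_cube k \<Longrightarrow> t < n \<Longrightarrow> V \<in> \<W> t \<Longrightarrow> ?chi z V \<le> ennreal c * I z V"
    for c d :: real and I :: "(nat \<Rightarrow> int) \<Rightarrow> ('x \<Rightarrow> 'y \<Rightarrow> real) \<Rightarrow> ennreal"
  proof -
    let ?S = "\<lambda>t. SUP z\<in>sign_cube k. SUP V\<in>\<W> t. I z V"
    have "ennreal ((1 / real k * ?tv)\<^sup>2) \<le> ennreal (2 / real k) * (\<Sum>t<n. ennreal c * ?S t)"
    proof (rule mixture_TV_sum_bound[OF k \<tau> p_prob p_sets])
      fix z t V assume z: "z \<in> sign_cube k" and t: "t < n" and V: "V \<in> \<W> t"
      have "I z V \<le> ?S t"
        using z V by (intro SUP_upper2[of z] SUP_upper)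
      then show "?chi z V \<le> ennreal c * ?S t"
        using I[OF z t V] by (meson mult_left_mono order_trans zero_le)
    qed
    also have "\<dots> = ennreal (2 / real k * c) * (\<Sum>t<n. ?S t)"
      using c by (simp add: sum_distrib_left[symmetric] ennreal_mult mult.assoc del: times_divide_eq_left)
    also have "\<dots> \<le> ennreal d * (\<Sum>t<n. ?S t)"
      using c by (intro mult_right_mono ennreal_leI) auto
    finally show ?thesis .
  qed
  show ?thesis
  proof (intro conjI allI impI)
    show "ennreal ((1 / real k * ?tv)\<^sup>2) \<le> ennreal (7 / real k * \<alpha>\<^sup>2) *
        (\<Sum>t<n. SUP z\<in>sign_cube k. SUP V\<in>\<W> t.
          \<integral>\<^sup>+y. ext_variance (p z) (\<lambda>x. V x y) / ennreal (\<integral>x. V x y \<partial>p z) \<partial>\<mu>)"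
    proof (rule main)
      fix z t V assume "z \<in> sign_cube k" "t < n" "V \<in> \<W> t"
      then interpret perturbed_inputs "p z" \<mu> V k "\<lambda>i. p (flip z i)" "a z" "\<phi> z" \<alpha>
        by (rule perturbed)
      show "?chi z V \<le> ennreal (\<alpha>\<^sup>2) *
          (\<integral>\<^sup>+y. ext_variance (p z) (\<lambda>x. V x y) / ennreal (\<integral>x. V x y \<partial>p z) \<partial>\<mu>)"
        using sum_chi_square_le_variance by (simp add: mean_density_def[of "p z"])
    qed (use k in \<open>auto intro!: mult_right_mono divide_right_mono\<close>)
  next
    fix \<sigma> :: real
    assume sub: "\<forall>z\<in>sign_cube k. subgaussian_vector (\<sigma>\<^sup>2) k (p z) (\<phi> z) \<and>
      prob_space.indep_vars (p z) (\<lambda>_. borel) (\<phi> z) {..<k}"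
    show "ennreal ((1 / real k * ?tv)\<^sup>2) \<le> ennreal (14 * ln 2 / real k * \<alpha>\<^sup>2 * \<sigma>\<^sup>2) *
        (\<Sum>t<n. SUP z\<in>sign_cube k. SUP V\<in>\<W> t. channel_information (p z) \<mu> V)"
    proof (rule main)
      show "0 \<le> 2 * ln 2 * \<alpha>\<^sup>2 * \<sigma>\<^sup>2"
        by simp
      show "2 / real k * (2 * ln 2 * \<alpha>\<^sup>2 * \<sigma>\<^sup>2) \<le> 14 * ln 2 / real k * \<alpha>\<^sup>2 * \<sigma>\<^sup>2"
        by (simp add: divide_right_mono)
      fix z t V assume z: "z \<in> sign_cube k" and "t < n" "V \<in> \<W> t"
      then interpret perturbed_inputs "p z" \<mu> V k "\<lambda>i. p (flip z i)" "a z" "\<phi> z" \<alpha>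
        by (rule perturbed)
      show "?chi z V \<le> ennreal (2 * ln 2 * \<alpha>\<^sup>2 * \<sigma>\<^sup>2) * channel_information (p z) \<mu> V"
        using sub z k by (intro sum_chi_square_le_information) auto
    qed
  qed
qed

end
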